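(* Let $G_1$ and $G_2$ be finite simple connected graphs, let $Y$ be a nonempty graph which is a full subgraph of both $G_1$ and $G_2$, and let $G = G_1\cup_Y G_2$. Then $$N(G,F)=N(G_1,F)\,N(G_2,F)\,\frac{\det\big(\mathrm{DN}(G_1,Y,G_2,1)\big)}{\det\big(\mathrm{DN}(G_1,Y,1)\big)\,\det\big(\mathrm{DN}(G_2,Y,1)\big)}.$$
   Context: $N(H,F)$ denotes the number of all rooted spanning forests of $H$, i.e. spanning acyclic subgraphs of $H$ together with a choice of one root vertex in each connected component. A subgraph $Y$ of a graph $H$ is full if $u,v\in V(Y)$ and $\{u,v\}\in E(H)$ imply $\{u,v\}\in E(Y)$. If $Y$ is a full subgraph of $G_1$ and of $G_2$, then $G_1\cup_Y G_2$ is the graph obtained from the disjoint union of $G_1$ and $G_2$ by identifying the two copies of each vertex of $Y$ and the two copies of each edge of $Y$. $L(H)$ is the graph Laplacian: $L(H)(u,u)$ is the degree of $u$ in $H$, $L(H)(u,v)=-1$ if $\{u,v\}\in E(H)$, and $0$ otherwise. Put $C(H,\lambda)=L(H)+\lambda I$. Dirichlet-to-Neumann map: for a nonempty full subgraph $Y$ of $H$, write $C(H,\lambda)=\begin{bmatrix} A(\lambda) & B\\ B^T & D(\lambda)\end{bmatrix}$ with $A(\lambda)$ indexed by $V(H)\setminus V(Y)$ and $D(\lambda)$ by $V(Y)$. When $A(\lambda)$ is invertible (in particular for $\lambda\ge 0$), $\mathrm{DN}(H,Y,\lambda)=D(\lambda)-B^TA(\lambda)^{-1}B$, a matrix indexed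 by $V(Y)$. Finally, $$\mathrm{DN}(G_1,Y,G_2,\lambda)=\mathrm{DN}(G_1,Y,\lambda)+\mathrm{DN}(G_2,Y,\lambda)-C(Y,\lambda).$$ *)

theory Defs
  imports
    "Graph_Theory.Graph_Theory"
    "Jordan_Normal_Form.Determinant"
    "Jordan_Normal_Form.Gauss_Jordan_Elimination"
    "HOL-Library.Countable_Set"
    "HOL-Library.FuncSet"
begin

text \<open>
  A finite simple graph is a \<^locale>\<open>pair_graph\<close>: an undirected edge \<open>{u,v}\<close> is the pair of
  arcs \<open>(u,v)\<close>, \<open>(v,u)\<close>.  Full subgraphs are \<^const>\<open>induced_subgraph\<close>s, and since arcs are
  symmetric the connected components are the strongly connected ones
  (\<^const>\<open>pre_digraph.sccs_verts\<close> gives their vertex sets).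
\<close>

text \<open>
  \<^const>\<open>forest\<close> cannot be used for graphs in this representation: it counts the closed walk
  \<open>u, v, u\<close> along a single edge as a cycle.  Cycles of an undirected simple graph have
  length at least 3.
\<close>

definition acyclic_graph :: "'a pair_pre_digraph \<Rightarrow> bool" where
  "acyclic_graph F \<longleftrightarrow> pair_graph F \<and> \<not> (\<exists>p. pre_digraph.cycle (with_proj F) p \<and> 3 \<le> length p)"

definition rooted_spanning_forests ::
    "'a pair_pre_digraph \<Rightarrow> ('a pair_pre_digraph \<times> ('a set \<Rightarrow> 'a)) set" where
  "rooted_spanning_forests H =
     {(F, root). spanning (with_proj F) (with_proj H) \<and> acyclic_graph F \<and>
        root \<in> (\<Pi>\<^sub>E S\<in>pre_digraph.sccs_verts (with_proj F). S)}"

definition num_rooted_forests :: "'a pair_pre_digraph \<Rightarrow> nat" where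
  "num_rooted_forests H = card (rooted_spanning_forests H)"

text \<open>
  The vertices of \<open>G1 \<union>\<^sub>Y G2\<close> are equivalence classes in the disjoint union.  Vertices of \<open>G1\<close>
  and \<open>G2\<close> outside \<open>Y\<close> are kept apart even if they are equal as elements of \<^typ>\<open>'a\<close>.
  The two copies of an edge of \<open>Y\<close> have the same image, so the union of arcs identifies them.
\<close>

definition glue_rel :: "'a pair_pre_digraph \<Rightarrow> ('a + 'a) rel" where
  "glue_rel Y = Id \<union> {(Inl v, Inr v) | v. v \<in> pverts Y} \<union> {(Inr v, Inl v) | v. v \<in> pverts Y}"

definition glue ::
    "'a pair_pre_digraph \<Rightarrow> 'a pair_pre_digraph \<Rightarrow> 'a pair_pre_digraph \<Rightarrow> ('a + 'a) set pair_pre_digraph"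
where
  "glue G1 Y G2 =
     \<lparr> pverts = (pverts G1 <+> pverts G2) // glue_rel Y,
       parcs = (\<lambda>(u, v). (glue_rel Y `` {Inl u}, glue_rel Y `` {Inl v})) ` parcs G1 \<union>
               (\<lambda>(u, v). (glue_rel Y `` {Inr u}, glue_rel Y `` {Inr v})) ` parcs G2 \<rparr>"

definition laplacian :: "'a pair_pre_digraph \<Rightarrow> 'a \<Rightarrow> 'a \<Rightarrow> real" where
  "laplacian H u v =
     (if u = v then real (out_degree (with_proj H) u)
      else if (u, v) \<in> parcs H then - 1 else 0)"

text \<open>
  The block of \<open>C(H,\<lambda>) = L(H) + \<lambda>I\<close> with rows indexed by \<open>I\<close> and columns by \<open>J\<close>.
  A finite set \<open>I\<close> is enumerated by \<open>from_nat_into I\<close>, a bijection from \<open>{..<card I}\<close> to \<open>I\<close>.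
  The same enumeration is used for rows and for columns and for every graph, so sums and
  products of blocks match and the determinants do not depend on the enumeration.
\<close>

definition C_block :: "'a pair_pre_digraph \<Rightarrow> real \<Rightarrow> 'a set \<Rightarrow> 'a set \<Rightarrow> real mat" where
  "C_block H lam I J =
     mat (card I) (card J)
       (\<lambda>(i, j). let u = from_nat_into I i; v = from_nat_into J j
                 in laplacian H u v + (if u = v then lam else 0))"

definition C_mat :: "'a pair_pre_digraph \<Rightarrow> real \<Rightarrow> real mat" where
  "C_mat H lam = C_block H lam (pverts H) (pverts H)"

text \<open>Meaningful only if the block \<open>A\<close> is invertible, as is the case for \<open>\<lambda> > 0\<close>.\<close>

definition DN :: "'a pair_pre_digraph \<Rightarrow> 'a pair_pre_digraph \<Rightarrow> real \<Rightarrow> real mat" where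
  "DN H Y lam =
     (let A = C_block H lam (pverts H - pverts Y) (pverts H - pverts Y);
          B = C_block H lam (pverts H - pverts Y) (pverts Y);
          D = C_block H lam (pverts Y) (pverts Y)
      in D - transpose_mat B * the (mat_inverse A) * B)"

definition DN_glue ::
    "'a pair_pre_digraph \<Rightarrow> 'a pair_pre_digraph \<Rightarrow> 'a pair_pre_digraph \<Rightarrow> real \<Rightarrow> real mat" where
  "DN_glue G1 Y G2 lam = DN G1 Y lam + DN G2 Y lam - C_mat Y lam"

end

theory Submission
  imports Defs
begin

text \<open>
  Both sides are evaluated through the matrix forest theorem: the number of rooted spanning forests
  of a graph \<open>H\<close> is \<open>det (L(H) + I)\<close>.

  The matrix forest theorem is proved by encoding a rooted forest as a parent map: each vertex is sent
  to the next vertex on the way to its root, and roots are fixed.  The map determines the rooted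
  forest and conversely (\<open>num_rooted_forests_eq_parent_maps\<close>).  On the matrix side, row \<open>u\<close> of \<open>L(H) + I\<close>
  is the sum, over all admissible parents \<open>x\<close> of \<open>u\<close>, of the row \<open>e_u - e_x\<close> (or \<open>e_u\<close> for a root).
  Multilinearity turns the determinant into a sum over all choices of parents, in which a choice
  contributes 1 if all orbits end at a root and 0 if there is a cycle (\<open>det_laplacian_parent_maps\<close>).

  The Dirichlet-to-Neumann matrix is a Schur complement.  If \<open>A\<close>, \<open>A1\<close> and \<open>A2\<close> are the blocks of
  \<open>L + I\<close> for the vertices outside \<open>Y\<close> in a graph \<open>H\<close>, in \<open>G1\<close> and in \<open>G2\<close>, then
  \<open>N(H) = det A * det (DN H Y 1)\<close> (\<open>num_rooted_forests_eq_det_DN\<close>).  In the glued graph no edge joins a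
  vertex of \<open>G1\<close> outside \<open>Y\<close> to a vertex of \<open>G2\<close> outside \<open>Y\<close>, so the block of vertices outside \<open>Y\<close> is
  the direct sum of \<open>A1\<close> and \<open>A2\<close>, and \<open>N(G) = det A1 * det A2 * det (DN_glue G1 Y G2 1)\<close>
  (\<open>num_rooted_forests_glue\<close>).  All the determinants divided by are nonzero by diagonal dominance,
  and \<open>det A1\<close> and \<open>det A2\<close> cancel.
\<close>

section \<open>Counting parent maps by a determinant\<close>

definition halts :: "('a \<Rightarrow> 'a) \<Rightarrow> 'a \<Rightarrow> bool" where
  "halts f u \<longleftrightarrow> (\<exists>k. f ((f ^^ k) u) = (f ^^ k) u)"

text \<open>
  Number of steps until the orbit of \<open>u\<close> becomes stationary; an arbitrary value if it never does.
\<close>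

definition depth :: "('a \<Rightarrow> 'a) \<Rightarrow> 'a \<Rightarrow> nat" where
  "depth f u = (LEAST k. f ((f ^^ k) u) = (f ^^ k) u)"

lemma halts_step: "halts f (f u) \<longleftrightarrow> halts f u"
proof
  assume "halts f (f u)"
  then obtain k where "f ((f ^^ k) (f u)) = (f ^^ k) (f u)" by (auto simp: halts_def)
  then have "f ((f ^^ Suc k) u) = (f ^^ Suc k) u" by (simp only: funpow_Suc_right o_apply)
  then show "halts f u" unfolding halts_def by blast
next
  assume "halts f u"
  then obtain k where k: "f ((f ^^ k) u) = (f ^^ k) u" by (auto simp: halts_def)
  have "f ((f ^^ k) (f u)) = (f ^^ k) (f u)"
    using k by (metis funpow_swap1)
  then show "halts f (f u)" unfolding halts_def by blast
qed

lemma depth_step: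
  assumes "halts f u" "f u \<noteq> u"
  shows "depth f u = Suc (depth f (f u))"
proof -
  from assms(1) obtain k where k: "f ((f ^^ k) u) = (f ^^ k) u" by (auto simp: halts_def)
  have "(LEAST k. f ((f ^^ k) u) = (f ^^ k) u) = Suc (LEAST k. f ((f ^^ Suc k) u) = (f ^^ Suc k) u)"
    using assms(2) by (intro Least_Suc[where n = k] k) simp
  then show ?thesis by (simp only: depth_def funpow_Suc_right o_apply)
qed

text \<open>
  Induction along the orbit, from its stationary point back to the given vertex.
\<close>

lemma halts_induct [consumes 1, case_names root step]:
  assumes "halts f u"
    and "\<And>u. f u = u \<Longrightarrow> P u"
    and "\<And>u. halts f u \<Longrightarrow> f u \<noteq> u \<Longrightarrow> P (f u) \<Longrightarrow> P u"
  shows "P u"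
  using assms(1)
proof (induction "depth f u" arbitrary: u rule: less_induct)
  case less
  show ?case
  proof (cases "f u = u")
    case False
    with less.prems have "depth f u = Suc (depth f (f u))" by (rule depth_step)
    with less have "P (f u)" by (simp add: halts_step)
    with less.prems False show ?thesis by (blast intro: assms(3))
  qed (rule assms(2))
qed

text \<open>
  Row \<open>u\<close> of a parent map that sends \<open>u\<close> to \<open>x\<close>: the vector \<open>e_u - e_x\<close>, or just \<open>e_u\<close> when
  \<open>x = u\<close>, that is, when \<open>u\<close> is a root.
\<close>

definition parent_entry :: "'a \<Rightarrow> 'a \<Rightarrow> 'a \<Rightarrow> real" where
  "parent_entry u x v = (if v = u then 1 else if v = x then - 1 else 0)"

text \<open>
  Multilinearity of the determinant in all rows at once: each row is a sum over the possible choices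
  \<open>x \<in> P u\<close>, so the determinant is a sum over the functions that make a choice for every row.
\<close>

lemma det_sum_choices:
  fixes a :: "'a \<Rightarrow> 'b \<Rightarrow> 'a \<Rightarrow> real"
  assumes e: "bij_betw e {..<n} V" and fin: "\<And>u. u \<in> V \<Longrightarrow> finite (P u)"
  shows "det (mat n n (\<lambda>(i, j). \<Sum>x\<in>P (e i). a (e i) x (e j))) =
    (\<Sum>f\<in>PiE V P. det (mat n n (\<lambda>(i, j). a (e i) (f (e i)) (e j))))"
proof -
  have finV: "finite V" using e bij_betw_finite by blast
  define d where "d = the_inv_into {..<n} e"
  have d: "d (e i) = i" if "i < n" for i
    unfolding d_def using e that by (intro the_inv_into_f_f) (auto simp: bij_betw_def)
  have reindex: "(\<Prod>i = 0..<n. g (e i) (e (p i))) = (\<Prod>u\<in>V. g u (e (p (d u))))"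
    for p and g :: "'a \<Rightarrow> 'a \<Rightarrow> real"
  proof -
    have "(\<Prod>i = 0..<n. g (e i) (e (p i))) = (\<Prod>i\<in>{..<n}. g (e i) (e (p (d (e i)))))"
      by (rule prod.cong) (auto simp: d)
    also have "\<dots> = (\<Prod>u\<in>V. g u (e (p (d u))))"
      using prod.reindex_bij_betw[OF e, of "\<lambda>u. g u (e (p (d u)))"] by simp
    finally show ?thesis .
  qed
  have expand: "det (mat n n (\<lambda>(i, j). g (e i) (e j))) =
      (\<Sum>p\<in>{p. p permutes {0..<n}}. signof p * (\<Prod>u\<in>V. g u (e (p (d u)))))" for g :: "'a \<Rightarrow> 'a \<Rightarrow> real"
  proof -
    have "(\<Prod>i = 0..<n. mat n n (\<lambda>(i, j). g (e i) (e j)) $$ (i, p i)) =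
        (\<Prod>u\<in>V. g u (e (p (d u))))" if "p permutes {0..<n}" for p
    proof -
      have "p i < n" if "i < n" for i
        using permutes_in_image[OF \<open>p permutes {0..<n}\<close>, of i] that by simp
      then have "(\<Prod>i = 0..<n. mat n n (\<lambda>(i, j). g (e i) (e j)) $$ (i, p i)) =
          (\<Prod>i = 0..<n. g (e i) (e (p i)))"
        by (intro prod.cong) auto
      then show ?thesis by (rule trans[OF _ reindex])
    qed
    then show ?thesis by (subst det_def'[of _ n]) (auto intro!: sum.cong)
  qed
  have "det (mat n n (\<lambda>(i, j). \<Sum>x\<in>P (e i). a (e i) x (e j))) =
      (\<Sum>p\<in>{p. p permutes {0..<n}}. signof p * (\<Prod>u\<in>V. \<Sum>x\<in>P u. a u x (e (p (d u)))))"
    by (rule expand[of "\<lambda>u v. \<Sum>x\<in>P u. a u x v"])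
  also have "\<dots> = (\<Sum>p\<in>{p. p permutes {0..<n}}. \<Sum>f\<in>PiE V P.
      signof p * (\<Prod>u\<in>V. a u (f u) (e (p (d u)))))"
    by (intro sum.cong refl, subst prod_sum_PiE) (auto simp: finV fin sum_distrib_left)
  also have "\<dots> = (\<Sum>f\<in>PiE V P. \<Sum>p\<in>{p. p permutes {0..<n}}.
      signof p * (\<Prod>u\<in>V. a u (f u) (e (p (d u)))))"
    by (rule sum.swap)
  also have "\<dots> = (\<Sum>f\<in>PiE V P. det (mat n n (\<lambda>(i, j). a (e i) (f (e i)) (e j))))"
    by (intro sum.cong refl expand[symmetric, of "\<lambda>u. a u (_ u)"])
  finally show ?thesis .
qed

text \<open>
  Only the identity permutation contributes.  A permutation \<open>p\<close> with nonzero contribution sends each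
  \<open>u\<close> to \<open>u\<close> or to \<open>f u\<close>.  It must fix the roots, and if it fixes \<open>f u\<close>, then by injectivity it cannot
  send \<open>u\<close> there; so it fixes everything, by induction along the orbits.
\<close>

lemma det_parent_halts:
  assumes e: "bij_betw e {..<n} V" and h: "\<forall>u\<in>V. halts f u"
  shows "det (mat n n (\<lambda>(i, j). parent_entry (e i) (f (e i)) (e j))) = 1"
proof -
  let ?M = "mat n n (\<lambda>(i, j). parent_entry (e i) (f (e i)) (e j))"
  have inj: "e i = e j \<longleftrightarrow> i = j" if "i < n" "j < n" for i j
    using e that by (auto simp: bij_betw_def inj_on_def)
  have eV: "e i \<in> V" if "i < n" for i using e that by (auto simp: bij_betw_def)
  have only_id: "p = id"
    if p: "p permutes {0..<n}" and nz: "(\<Prod>i = 0..<n. ?M $$ (i, p i)) \<noteq> 0" for p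
  proof -
    have pn: "p i < n" if "i < n" for i
      using permutes_in_image[OF p, of i] that by simp
    have sel: "e (p i) = e i \<or> e (p i) = f (e i)" if "i < n" for i
    proof -
      have "?M $$ (i, p i) \<noteq> 0" using nz that by auto
      then show ?thesis using that pn[OF that] by (auto simp: parent_entry_def split: if_splits)
    qed
    have "p i = i" if "u = e i" "i < n" "halts f u" for u i
      using that(3,1,2)
    proof (induction arbitrary: i rule: halts_induct)
      case (root u)
      then show ?case using sel[of i] inj pn by metis
    next
      case (step u)
      show ?case
      proof (rule ccontr)
        assume "p i \<noteq> i"
        then have "e (p i) = f u" using sel[of i] inj pn step by metis
        then have "p (p i) = p i" using step pn by metis
        then show False using \<open>p i \<noteq> i\<close> permutes_inj[OF p] by (auto dest: injD)
      qed
    qed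
    then have "p i = i" if "i < n" for i using that h eV by blast
    moreover have "p i = i" if "\<not> i < n" for i using p that by (auto simp: permutes_def)
    ultimately have "p i = i" for i by (cases "i < n") blast+
    then show ?thesis by (simp add: fun_eq_iff)
  qed
  have "det ?M = (\<Sum>p\<in>{p. p permutes {0..<n}}. signof p * (\<Prod>i = 0..<n. ?M $$ (i, p i)))"
    by (rule det_def') simp
  also have "\<dots> = (\<Sum>p\<in>{id}. signof p * (\<Prod>i = 0..<n. ?M $$ (i, p i)))"
    using only_id by (intro sum.mono_neutral_right) (auto simp: finite_permutations permutes_id)
  also have "\<dots> = 1" by (simp add: parent_entry_def)
  finally show ?thesis .
qed

text \<open>
  The indicator function of the set of vertices whose orbit never becomes stationary is a nonzero
  vector in the kernel: membership in this set is the same for \<open>u\<close> and for \<open>f u\<close>, and roots are outside.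
\<close>

lemma det_parent_loops:
  assumes e: "bij_betw e {..<n} V" and f: "f \<in> V \<rightarrow> V" and w: "w \<in> V" "\<not> halts f w"
  shows "det (mat n n (\<lambda>(i, j). parent_entry (e i) (f (e i)) (e j))) = 0"
proof -
  let ?M = "mat n n (\<lambda>(i, j). parent_entry (e i) (f (e i)) (e j))"
  define y where "y = (\<lambda>u. if halts f u then 0 else 1 :: real)"
  define x where "x = vec n (\<lambda>i. y (e i))"
  have finV: "finite V" using e bij_betw_finite by blast
  obtain i where i: "i < n" "e i = w" using e w by (auto simp: bij_betw_def)
  have "x $ i \<noteq> 0" using i w by (simp add: x_def y_def)
  then have "x \<noteq> 0\<^sub>v n" using i by auto
  moreover have "?M *\<^sub>v x = 0\<^sub>v n"
  proof (rule eq_vecI)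
    fix i assume "i < dim_vec (0\<^sub>v n)"
    then have i: "i < n" by simp
    let ?u = "e i"
    have u: "?u \<in> V" using e i by (auto simp: bij_betw_def)
    then have fu: "f ?u \<in> V" using f by auto
    have "(?M *\<^sub>v x) $ i = (\<Sum>j = 0..<n. parent_entry ?u (f ?u) (e j) * y (e j))"
      using i by (simp add: x_def scalar_prod_def)
    also have "\<dots> = (\<Sum>v\<in>V. parent_entry ?u (f ?u) v * y v)"
      using sum.reindex_bij_betw[OF e, of "\<lambda>v. parent_entry ?u (f ?u) v * y v"]
      by (simp add: atLeast0LessThan)
    also have "\<dots> = (\<Sum>v\<in>V. (if v = ?u then y v else 0) -
        (if v = f ?u then (if f ?u = ?u then 0 else y v) else 0))"
      by (intro sum.cong) (auto simp: parent_entry_def)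
    also have "\<dots> = y ?u - (if f ?u = ?u then 0 else y (f ?u))"
      using u fu finV by (simp add: sum_subtractf)
    also have "\<dots> = 0"
    proof (cases "f ?u = ?u")
      case True
      then have "halts f ?u" unfolding halts_def by (intro exI[of _ 0]) simp
      then show ?thesis using True by (simp add: y_def)
    qed (simp add: y_def halts_step)
    finally show "(?M *\<^sub>v x) $ i = 0\<^sub>v n $ i" using i by simp
  qed simp
  ultimately show ?thesis
    by (subst det_0_iff_vec_prod_zero[of _ n]) (auto intro!: exI[of _ x] simp: x_def)
qed

text \<open>
  A root is encoded as its own parent.  The requirement that all orbits halt excludes cycles,
  including those that run back and forth along a single edge.
\<close>

definition parent_maps :: "'a pair_pre_digraph \<Rightarrow> ('a \<Rightarrow> 'a) set" where
  "parent_maps H = {f \<in> (\<Pi>\<^sub>E u\<in>pverts H. insert u {v. (u, v) \<in> parcs H}).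
     \<forall>u\<in>pverts H. halts f u}"

lemma out_degree_conv_card:
  "out_degree (with_proj H) u = card {v. (u, v) \<in> parcs H}"
proof -
  have "out_arcs (with_proj H) u = Pair u ` {v. (u, v) \<in> parcs H}"
    by (auto simp: out_arcs_def)
  then show ?thesis by (simp add: out_degree_def card_image inj_on_def)
qed

definition shifted_laplacian :: "'a pair_pre_digraph \<Rightarrow> real \<Rightarrow> 'a \<Rightarrow> 'a \<Rightarrow> real" where
  "shifted_laplacian H lam u v = laplacian H u v + (if u = v then lam else 0)"

text \<open>
  Row \<open>u\<close> of \<open>L(H) + I\<close> is the sum of \<open>e_u\<close> and of the vectors \<open>e_u - e_v\<close> over the neighbours \<open>v\<close>, i.e.
  one summand for each possible parent of \<open>u\<close>.  Expanding all rows gives one determinant per choice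
  of parents, equal to 1 if the choice has no cycle and to 0 otherwise.  The enumeration \<open>e\<close> of the
  vertices is arbitrary, which later allows an order adapted to the blocks.
\<close>

lemma det_laplacian_parent_maps:
  assumes H: "pair_graph H" and e: "bij_betw e {..<n} (pverts H)"
  shows "det (mat n n (\<lambda>(i, j). shifted_laplacian H 1 (e i) (e j))) = real (card (parent_maps H))"
proof -
  interpret H: pair_graph H by fact
  let ?V = "pverts H"
  define P where "P = (\<lambda>u. insert u {v. (u, v) \<in> parcs H})"
  have nbV: "{v. (u, v) \<in> parcs H} \<subseteq> ?V" for u by (auto dest: H.in_arcsD2)
  have fin_nb: "finite {v. (u, v) \<in> parcs H}" for u
    by (rule finite_subset[OF nbV H.pair_finite_verts])
  have PV: "P u \<subseteq> ?V" if "u \<in> ?V" for u using that nbV by (auto simp: P_def)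
  have finP: "finite (P u)" for u using fin_nb by (simp add: P_def)
  have entry: "(\<Sum>x\<in>P u. parent_entry u x v) = shifted_laplacian H 1 u v" for u v
  proof -
    have notin: "u \<notin> {v. (u, v) \<in> parcs H}" by (auto dest: H.no_loops')
    show ?thesis
    proof (cases "u = v")
      case True
      then have "(\<Sum>x\<in>P u. parent_entry u x v) = real (card (P u))" by (simp add: parent_entry_def)
      also have "\<dots> = shifted_laplacian H 1 u v"
        using True notin fin_nb[of u]
        by (simp add: P_def shifted_laplacian_def laplacian_def out_degree_conv_card)
      finally show ?thesis .
    next
      case False
      then have "(\<Sum>x\<in>P u. parent_entry u x v) = (\<Sum>x\<in>P u. if x = v then - 1 else 0)"
        by (intro sum.cong) (auto simp: parent_entry_def)
      also have "\<dots> = (if v \<in> P u then - 1 else 0)" by (simp add: finP)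
      finally show ?thesis
        using False by (auto simp: P_def shifted_laplacian_def laplacian_def)
    qed
  qed
  have "det (mat n n (\<lambda>(i, j). shifted_laplacian H 1 (e i) (e j))) =
      det (mat n n (\<lambda>(i, j). \<Sum>x\<in>P (e i). parent_entry (e i) x (e j)))"
    by (simp only: entry)
  also have "\<dots> = (\<Sum>f\<in>PiE ?V P. det (mat n n (\<lambda>(i, j). parent_entry (e i) (f (e i)) (e j))))"
    by (rule det_sum_choices[OF e finP])
  also have "\<dots> = (\<Sum>f\<in>PiE ?V P. if \<forall>u\<in>?V. halts f u then 1 else 0)"
  proof (rule sum.cong[OF refl])
    fix f assume "f \<in> PiE ?V P"
    then have f: "f \<in> ?V \<rightarrow> ?V" using PV by (fastforce simp: PiE_iff)
    show "det (mat n n (\<lambda>(i, j). parent_entry (e i) (f (e i)) (e j))) =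
        (if \<forall>u\<in>?V. halts f u then 1 else 0)"
      using det_parent_halts[OF e] det_parent_loops[OF e f] by auto
  qed
  also have "\<dots> = real (card {f \<in> PiE ?V P. \<forall>u\<in>?V. halts f u})"
  proof -
    have "finite (PiE ?V P)" by (intro finite_PiE H.pair_finite_verts finP)
    then show ?thesis by (simp add: sum.inter_filter[symmetric])
  qed
  also have "{f \<in> PiE ?V P. \<forall>u\<in>?V. halts f u} = parent_maps H"
    by (simp add: parent_maps_def P_def)
  finally show ?thesis .
qed

section \<open>Parent maps and rooted spanning forests\<close>

definition root_of :: "('a \<Rightarrow> 'a) \<Rightarrow> 'a \<Rightarrow> 'a" where
  "root_of f u = (f ^^ depth f u) u"

lemma depth_root: "f u = u \<Longrightarrow> depth f u = 0"
  by (simp add: depth_def)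

lemma root_of_root: "f u = u \<Longrightarrow> root_of f u = u"
  by (simp add: root_of_def depth_root)

lemma root_of_step: "halts f u \<Longrightarrow> root_of f (f u) = root_of f u"
  by (cases "f u = u") (simp_all add: root_of_def depth_step funpow_swap1)

lemma root_of_fixed: "halts f u \<Longrightarrow> f (root_of f u) = root_of f u"
  by (induction rule: halts_induct) (simp_all add: root_of_root root_of_step)

lemma root_of_eq_iff: "halts f u \<Longrightarrow> root_of f u = u \<longleftrightarrow> f u = u"
  using root_of_fixed[of f u] root_of_root[of f u] by auto

text \<open>
  The graph whose edges join each vertex to its parent; the condition \<open>u \<noteq> v\<close> removes the loops
  that encode roots.
\<close>

definition forest_of :: "'a set \<Rightarrow> ('a \<Rightarrow> 'a) \<Rightarrow> 'a pair_pre_digraph" where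
  "forest_of V f = \<lparr> pverts = V, parcs = {(u, v) \<in> V \<times> V. u \<noteq> v \<and> (f u = v \<or> f v = u)} \<rparr>"

lemma forest_of_simps [simp]:
  "pverts (forest_of V f) = V"
  "(u, v) \<in> parcs (forest_of V f) \<longleftrightarrow> u \<in> V \<and> v \<in> V \<and> u \<noteq> v \<and> (f u = v \<or> f v = u)"
  by (simp_all add: forest_of_def)

lemma pair_graph_intro:
  assumes "finite (pverts G)" "parcs G \<subseteq> pverts G \<times> pverts G"
    and "sym (parcs G)" and "\<And>u. (u, u) \<notin> parcs G"
  shows "pair_graph G"
proof
  show "finite (parcs G)" using assms(1,2) by (meson finite_SigmaI finite_subset)
  show "symmetric (with_proj G)" using assms(3) by (simp add: symmetric_def)
  fix e assume e: "e \<in> parcs G"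
  show "fst e \<in> pverts G" "snd e \<in> pverts G" using e assms(2) by auto
  show "fst e \<noteq> snd e" using e assms(4) by (cases e) auto
qed (rule assms)

lemma pair_graph_forest_of: "finite V \<Longrightarrow> pair_graph (forest_of V f)"
  by (rule pair_graph_intro) (auto simp: sym_def)

lemma (in pair_graph) reachable_sym: "u \<rightarrow>\<^sup>*\<^bsub>with_proj G\<^esub> v \<longleftrightarrow> v \<rightarrow>\<^sup>*\<^bsub>with_proj G\<^esub> u"
  by (blast intro: symmetric_reachable')

lemma (in pair_graph) sccs_verts_eq:
  assumes "S \<in> sccs_verts" "u \<in> S"
  shows "S = {v. u \<rightarrow>\<^sup>*\<^bsub>with_proj G\<^esub> v}"
  using assms reachable_sym unfolding in_sccs_verts_conv_reachable by blast

lemma (in pair_graph) reachable_set_in_sccs_verts: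
  assumes "u \<in> pverts G"
  shows "{v. u \<rightarrow>\<^sup>*\<^bsub>with_proj G\<^esub> v} \<in> sccs_verts"
  unfolding in_sccs_verts_conv_reachable
proof (intro conjI ballI allI impI)
  have "u \<rightarrow>\<^sup>*\<^bsub>with_proj G\<^esub> u" using assms by simp
  then show "{v. u \<rightarrow>\<^sup>*\<^bsub>with_proj G\<^esub> v} \<noteq> {}" by blast
qed (use reachable_sym reachable_trans in blast)+

text \<open>
  The root is constant along edges, and every vertex is connected to its root.
\<close>

lemma reachable_forest_of_iff:
  assumes fin: "finite V" and f: "f \<in> V \<rightarrow> V" and h: "\<forall>u\<in>V. halts f u"
  shows "u \<rightarrow>\<^sup>*\<^bsub>with_proj (forest_of V f)\<^esub> v \<longleftrightarrow> u \<in> V \<and> v \<in> V \<and> root_of f u = root_of f v"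
proof -
  interpret F: pair_graph "forest_of V f" by (rule pair_graph_forest_of[OF fin])
  have to_root: "w \<rightarrow>\<^sup>*\<^bsub>with_proj (forest_of V f)\<^esub> root_of f w" if "halts f w" "w \<in> V" for w
    using that
  proof (induction rule: halts_induct)
    case (root w)
    then show ?case by (simp add: root_of_root)
  next
    case (step w)
    then have fw: "f w \<in> V" using f by auto
    then have "(w, f w) \<in> parcs (forest_of V f)" using step by simp
    moreover have "f w \<rightarrow>\<^sup>*\<^bsub>with_proj (forest_of V f)\<^esub> root_of f w"
      using step fw by (simp add: root_of_step)
    ultimately show ?case by (rule F.adj_reachable_trans)
  qed
  show ?thesis
  proof
    assume r: "u \<rightarrow>\<^sup>*\<^bsub>with_proj (forest_of V f)\<^esub> v"
    then have "root_of f u = root_of f v"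
    proof (induction rule: F.reachable_induct)
      case (step x y)
      then have "x \<in> V" "y \<in> V" "f x = y \<or> f y = x" by auto
      then have "root_of f x = root_of f y" using root_of_step h by metis
      with step show ?case by simp
    qed simp
    then show "u \<in> V \<and> v \<in> V \<and> root_of f u = root_of f v"
      using F.reachable_in_verts[OF r] by simp
  next
    assume "u \<in> V \<and> v \<in> V \<and> root_of f u = root_of f v"
    then show "u \<rightarrow>\<^sup>*\<^bsub>with_proj (forest_of V f)\<^esub> v"
      using to_root h F.reachable_sym F.reachable_trans by metis
  qed
qed

lemma pcas_nth_Suc:
  "pcas u p v \<Longrightarrow> Suc i < length p \<Longrightarrow> fst (p ! Suc i) = snd (p ! i)"
proof (induction p arbitrary: u i)
  case (Cons a p)
  then show ?case
  proof (cases i)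
    case 0
    then show ?thesis using Cons.prems by (cases p) auto
  next
    case (Suc k)
    then show ?thesis using Cons by auto
  qed
qed simp

lemma pcas_ends:
  "pcas u p v \<Longrightarrow> p \<noteq> [] \<Longrightarrow> fst (p ! 0) = u \<and> snd (p ! (length p - 1)) = v"
proof (induction p arbitrary: u)
  case (Cons a p)
  then show ?case by (cases p) auto
qed simp

text \<open>
  On a cycle take a vertex of maximal depth.  Both neighbours on the cycle must be its parent, since a
  child would be deeper.  A cycle of length at least 3 has two different neighbours there.
\<close>

lemma acyclic_graph_forest_of:
  assumes fin: "finite V" and h: "\<forall>u\<in>V. halts f u"
  shows "acyclic_graph (forest_of V f)"
proof -
  let ?F = "forest_of V f"
  interpret F: pair_graph ?F by (rule pair_graph_forest_of[OF fin])
  have False if cyc: "F.cycle p" and len: "3 \<le> length p" for p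
  proof -
    let ?n = "length p"
    obtain u where aw: "F.awalk u p u" and dist: "distinct (tl (pawalk_verts u p))"
      using cyc by (auto simp: F.cycle_def)
    have arcs: "set p \<subseteq> parcs ?F" and cas: "pcas u p u" using aw by (auto simp: F.awalk_def)
    have "p \<noteq> []" using len by auto
    have "pawalk_verts u p = fst (hd p) # map snd p"
      using F.awalk_verts_conv'[OF cas] \<open>p \<noteq> []\<close> by simp
    then have dsnd: "distinct (map snd p)" using dist by simp
    \<comment> \<open>Cyclic successor of a position on the cycle; the arc after \<open>p ! i\<close> starts where \<open>p ! i\<close> ends.\<close>
    define succ where "succ = (\<lambda>i. if Suc i = ?n then 0 else Suc i)"
    have succ_less: "succ i < ?n" if "i < ?n" for i using that by (auto simp: succ_def)
    have link: "fst (p ! succ i) = snd (p ! i)" if "i < ?n" for i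
    proof (cases "Suc i = ?n")
      case True
      then have "i = ?n - 1" by simp
      then show ?thesis using pcas_ends[OF cas \<open>p \<noteq> []\<close>] True by (simp add: succ_def)
    next
      case False
      then show ?thesis using pcas_nth_Suc[OF cas, of i] that by (simp add: succ_def)
    qed
    have arc: "(fst (p ! i), snd (p ! i)) \<in> parcs ?F" if "i < ?n" for i
      using arcs that by auto
    obtain i where i: "i < ?n" and max: "\<And>j. j < ?n \<Longrightarrow> depth f (snd (p ! j)) \<le> depth f (snd (p ! i))"
    proof -
      let ?D = "(\<lambda>j. depth f (snd (p ! j))) ` {..<?n}"
      have "?D \<noteq> {}" "finite ?D" using \<open>p \<noteq> []\<close> by auto
      then have "Max ?D \<in> ?D" "\<forall>d\<in>?D. d \<le> Max ?D" by (simp_all del: Max_less_iff)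
      then obtain j where "j < ?n" "depth f (snd (p ! j)) = Max ?D" by auto
      with \<open>\<forall>d\<in>?D. d \<le> Max ?D\<close> show ?thesis by (intro that[of j]) auto
    qed
    let ?w = "snd (p ! i)"
    have up: "x = f ?w"
      if "(x, ?w) \<in> parcs ?F \<or> (?w, x) \<in> parcs ?F" "j < ?n" "x = snd (p ! j)" for x j
    proof (rule ccontr)
      assume "x \<noteq> f ?w"
      then have "f x = ?w" "x \<noteq> ?w" "x \<in> V" using that(1) by auto
      then have "depth f x = Suc (depth f ?w)" using depth_step[of f x] h by auto
      then show False using max[OF that(2)] that(3) by simp
    qed
    define k where "k = (if i = 0 then ?n - 1 else i - 1)"
    have k: "k < ?n" "succ k = i" using i len by (auto simp: k_def succ_def)
    have "snd (p ! k) = f ?w"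
      using link[OF k(1)] arc[OF i] k by (intro up[of _ k]) auto
    moreover have "snd (p ! succ i) = f ?w"
      using link[OF i] arc[OF succ_less[OF i]] succ_less[OF i] by (intro up[of _ "succ i"]) auto
    ultimately have "map snd p ! k = map snd p ! succ i" using k succ_less[OF i] by simp
    then have "k = succ i"
      using dsnd k succ_less[OF i] by (simp add: nth_eq_iff_index_eq del: nth_map)
    then show False using i len by (auto simp: k_def succ_def split: if_splits)
  qed
  then show ?thesis using F.pair_graph by (auto simp: acyclic_graph_def)
qed

lemma parent_mapsD:
  assumes H: "pair_graph H" and f: "f \<in> parent_maps H"
  shows "f \<in> pverts H \<rightarrow> pverts H" "\<forall>u\<in>pverts H. halts f u" "f \<in> extensional (pverts H)"
    "\<And>u. u \<in> pverts H \<Longrightarrow> f u \<noteq> u \<Longrightarrow> (u, f u) \<in> parcs H"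
proof -
  interpret H: pair_graph H by fact
  have mem: "f u \<in> insert u {v. (u, v) \<in> parcs H}" if "u \<in> pverts H" for u
    using f that by (auto simp: parent_maps_def PiE_iff)
  show "f \<in> pverts H \<rightarrow> pverts H"
  proof
    fix u assume "u \<in> pverts H"
    with mem[of u] show "f u \<in> pverts H" using H.in_arcsD2[of u "f u"] by auto
  qed
  show "\<forall>u\<in>pverts H. halts f u" "f \<in> extensional (pverts H)"
    using f by (simp_all add: parent_maps_def PiE_iff)
  show "(u, f u) \<in> parcs H" if "u \<in> pverts H" "f u \<noteq> u" for u
    using mem[OF that(1)] that(2) by simp
qed

lemma parcs_forest_of_subset:
  assumes H: "pair_graph H" and f: "f \<in> parent_maps H"
  shows "parcs (forest_of (pverts H) f) \<subseteq> parcs H"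
proof -
  interpret H: pair_graph H by fact
  note step = parent_mapsD(4)[OF assms]
  show ?thesis
  proof
    fix e assume "e \<in> parcs (forest_of (pverts H) f)"
    then obtain u v where e: "e = (u, v)" and uv: "u \<in> pverts H" "v \<in> pverts H" "u \<noteq> v"
      and "f u = v \<or> f v = u"
      by (cases e) auto
    then show "e \<in> parcs H" using step[of u] step[of v] H.arcs_symmetric by auto
  qed
qed

definition rooted_forest_of ::
    "'a set \<Rightarrow> ('a \<Rightarrow> 'a) \<Rightarrow> 'a pair_pre_digraph \<times> ('a set \<Rightarrow> 'a)" where
  "rooted_forest_of V f = (forest_of V f,
     \<lambda>S\<in>pre_digraph.sccs_verts (with_proj (forest_of V f)). root_of f (SOME u. u \<in> S))"

text \<open>
  The root assigned to a component does not depend on the vertex chosen to compute it.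
\<close>

lemma root_of_in_component:
  assumes fin: "finite V" and f: "f \<in> V \<rightarrow> V" and h: "\<forall>u\<in>V. halts f u"
    and S: "S \<in> pre_digraph.sccs_verts (with_proj (forest_of V f))"
  shows "root_of f (SOME u. u \<in> S) \<in> S"
    "u \<in> S \<Longrightarrow> root_of f (SOME u. u \<in> S) = root_of f u"
proof -
  interpret F: pair_graph "forest_of V f" by (rule pair_graph_forest_of[OF fin])
  note reach = reachable_forest_of_iff[OF fin f h]
  define s where "s = (SOME u. u \<in> S)"
  have "S \<noteq> {}" using S by (simp add: F.in_sccs_verts_conv_reachable)
  then have s: "s \<in> S" unfolding s_def by (simp add: some_in_eq)
  have mem: "v \<in> S \<longleftrightarrow> s \<in> V \<and> v \<in> V \<and> root_of f s = root_of f v" for v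
    by (subst F.sccs_verts_eq[OF S s]) (simp add: reach)
  have sV: "s \<in> V" using s mem by blast
  have inV: "(f ^^ k) s \<in> V" for k using sV f by (induction k) auto
  then have "root_of f s \<in> V" by (simp add: root_of_def)
  moreover have "root_of f (root_of f s) = root_of f s"
    using h sV by (intro root_of_root root_of_fixed) auto
  ultimately have "root_of f s \<in> S" using sV mem by simp
  then show "root_of f (SOME u. u \<in> S) \<in> S" by (simp only: s_def)
  show "root_of f (SOME u. u \<in> S) = root_of f u" if "u \<in> S"
  proof -
    have "root_of f s = root_of f u" using that mem by blast
    then show ?thesis by (simp only: s_def)
  qed
qed

lemma rooted_forest_of_mem:
  assumes H: "pair_graph H" and f: "f \<in> parent_maps H"
  shows "rooted_forest_of (pverts H) f \<in> rooted_spanning_forests H"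
proof -
  interpret H: pair_graph H by fact
  note D = parent_mapsD[OF assms]
  note fin = H.pair_finite_verts
  interpret F: pair_graph "forest_of (pverts H) f" by (rule pair_graph_forest_of[OF fin])
  have "spanning (with_proj (forest_of (pverts H) f)) (with_proj H)"
    using parcs_forest_of_subset[OF assms] H.wf_digraph F.wf_digraph
    by (auto simp: spanning_def subgraph_def compatible_def)
  then show ?thesis
    using acyclic_graph_forest_of[OF fin D(2)] root_of_in_component(1)[OF fin D(1,2)]
    by (auto simp: rooted_spanning_forests_def rooted_forest_of_def)
qed

text \<open>
  The forest and the roots determine the parents.  Equal roots give equal fixed points.  For any other
  vertex \<open>u\<close>, induct along the orbit: the edge from \<open>u\<close> to \<open>f u\<close> also belongs to the forest of \<open>g\<close>, so
  \<open>g u = f u\<close> or \<open>g (f u) = u\<close>; the latter would make \<open>u\<close> the parent of its own parent.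
\<close>

lemma inj_rooted_forest_of:
  assumes H: "pair_graph H"
  shows "inj_on (rooted_forest_of (pverts H)) (parent_maps H)"
proof (rule inj_onI)
  interpret H: pair_graph H by fact
  note fin = H.pair_finite_verts
  let ?V = "pverts H"
  fix f g assume f: "f \<in> parent_maps H" and g: "g \<in> parent_maps H"
    and eq: "rooted_forest_of ?V f = rooted_forest_of ?V g"
  note Df = parent_mapsD[OF H f] and Dg = parent_mapsD[OF H g]
  have forest_eq: "forest_of ?V f = forest_of ?V g" using eq by (simp add: rooted_forest_of_def)
  interpret F: pair_graph "forest_of ?V f" by (rule pair_graph_forest_of[OF fin])
  have root_eq: "root_of f u = root_of g u" if u: "u \<in> ?V" for u
  proof -
    let ?S = "{v. u \<rightarrow>\<^sup>*\<^bsub>with_proj (forest_of ?V f)\<^esub> v}"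
    have S: "?S \<in> F.sccs_verts" using u by (intro F.reachable_set_in_sccs_verts) simp
    have uS: "u \<in> ?S" using u by simp
    have "root_of f (SOME u. u \<in> ?S) = root_of g (SOME u. u \<in> ?S)"
      using S arg_cong[OF eq, of "\<lambda>x. snd x ?S"] forest_eq by (simp add: rooted_forest_of_def)
    moreover have "root_of f (SOME u. u \<in> ?S) = root_of f u"
      by (rule root_of_in_component(2)[OF fin Df(1,2) S uS])
    moreover have "root_of g (SOME u. u \<in> ?S) = root_of g u"
      by (rule root_of_in_component(2)[OF fin Dg(1,2) S[unfolded forest_eq] uS[unfolded forest_eq],
          folded forest_eq])
    ultimately show ?thesis by simp
  qed
  have fix_iff: "f u = u \<longleftrightarrow> g u = u" if "u \<in> ?V" for u
    using root_eq[OF that] root_of_eq_iff Df(2) Dg(2) that by metis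
  have "f u = g u" if "halts f u" "u \<in> ?V" for u
    using that
  proof (induction rule: halts_induct)
    case (root u)
    then show ?case using fix_iff by metis
  next
    case (step u)
    have fu: "f u \<in> ?V" using step Df(1) by auto
    have "(u, f u) \<in> parcs (forest_of ?V f)" using step fu by simp
    then have "g u = f u \<or> g (f u) = u" by (simp add: forest_eq)
    moreover have "g (f u) \<noteq> u"
    proof
      assume "g (f u) = u"
      then have "f (f u) = u" using step fu by simp
      then have "depth f u = Suc (Suc (depth f u))"
        using depth_step[of f u] depth_step[of f "f u"] step by (simp add: halts_step)
      then show False by simp
    qed
    ultimately show ?case by simp
  qed
  then have "f u = g u" if "u \<in> ?V" for u using Df(2) that by blast
  then show "f = g" using Df(3) Dg(3) by (intro extensionalityI)
qed

text \<open>
  An edge of \<open>F\<close> outside the subgraph \<open>T\<close> would close up a path of \<open>T\<close> between its ends.  Such a path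
  has at least two edges, as the edge itself is not in \<open>T\<close>, so the cycle would have length at least 3.
\<close>

lemma acyclic_graph_arc_of_reachable:
  assumes F: "acyclic_graph F" and T: "pair_graph T" and sub: "parcs T \<subseteq> parcs F"
    and uv: "(u, v) \<in> parcs F" and r: "u \<rightarrow>\<^sup>*\<^bsub>with_proj T\<^esub> v"
  shows "(u, v) \<in> parcs T"
proof (rule ccontr)
  assume notT: "(u, v) \<notin> parcs T"
  interpret F: pair_graph F using F by (simp add: acyclic_graph_def)
  interpret T: pair_graph T by fact
  obtain p where p: "T.apath u p v" using r by (auto simp: T.reachable_apath)
  have cas: "pcas u p v" and pT: "set p \<subseteq> parcs T" and dist: "distinct (pawalk_verts u p)"
    using p by (auto simp: T.apath_def T.awalk_def)
  have "u \<noteq> v" using uv by (rule F.no_loops')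
  have len: "2 \<le> length p"
  proof (rule ccontr)
    assume "\<not> 2 \<le> length p"
    then have "length p = 0 \<or> length p = 1" by linarith
    then show False
    proof
      assume "length p = 0"
      then show False using cas \<open>u \<noteq> v\<close> by simp
    next
      assume "length p = 1"
      then obtain a where "p = [a]" by (auto simp: length_Suc_conv)
      then show False using cas pT notT by (cases a) auto
    qed
  qed
  have "F.cycle ((v, u) # p)"
    using F.arcs_symmetric[OF uv] F.in_arcsD1 F.in_arcsD2 uv cas pT sub dist
    by (auto simp: F.cycle_def F.awalk_def)
  moreover have "3 \<le> length ((v, u) # p)" using len by simp
  ultimately show False using F by (auto simp: acyclic_graph_def)
qed

text \<open>
  Let every vertex that is not a root choose as its parent a neighbour closer to the root of its
  component.  The forest of this parent map lies in \<open>F\<close> and already connects all that \<open>F\<close> connects, so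
  acyclicity of \<open>F\<close> leaves no further edge.
\<close>

lemma rooted_forest_of_surj:
  assumes H: "pair_graph H" and mem: "(F, rt) \<in> rooted_spanning_forests H"
  shows "(F, rt) \<in> rooted_forest_of (pverts H) ` parent_maps H"
proof -
  interpret H: pair_graph H by fact
  note fin = H.pair_finite_verts
  have acyc: "acyclic_graph F" and span: "spanning (with_proj F) (with_proj H)"
    and rt: "rt \<in> (\<Pi>\<^sub>E S\<in>pre_digraph.sccs_verts (with_proj F). S)"
    using mem by (auto simp: rooted_spanning_forests_def)
  interpret F: pair_graph F using acyc by (simp add: acyclic_graph_def)
  have VF: "pverts F = pverts H" and sub: "parcs F \<subseteq> parcs H"
    using span by (auto simp: spanning_def subgraph_def)
  let ?V = "pverts H"
  let ?C = "\<lambda>u. {v. u \<rightarrow>\<^sup>*\<^bsub>with_proj F\<^esub> v}"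
  define r where "r = (\<lambda>u. rt (?C u))"
  have r_reach: "u \<rightarrow>\<^sup>*\<^bsub>with_proj F\<^esub> r u" if "u \<in> ?V" for u
  proof -
    have "?C u \<in> F.sccs_verts" using that VF by (intro F.reachable_set_in_sccs_verts) simp
    then have "rt (?C u) \<in> ?C u" using rt by auto
    then show ?thesis by (simp add: r_def)
  qed
  have r_cong: "r u = r v" if "u \<rightarrow>\<^sup>*\<^bsub>with_proj F\<^esub> v" for u v
  proof -
    have "?C u = ?C v" using that F.reachable_sym F.reachable_trans by blast
    then show ?thesis by (simp add: r_def)
  qed
  \<comment> \<open>Distance to the root of the component.\<close>
  define d where "d = (\<lambda>u. LEAST n. (u, r u) \<in> parcs F ^^ n)"
  have closer: "\<exists>v. (u, v) \<in> parcs F \<and> d v < d u" if u: "u \<in> ?V" and ne: "u \<noteq> r u" for u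
  proof -
    have "(u, r u) \<in> (parcs F)\<^sup>*" using r_reach[OF u] F.reachable_conv by simp
    then obtain n where "(u, r u) \<in> parcs F ^^ n" by (auto dest: rtrancl_imp_relpow)
    then have du: "(u, r u) \<in> parcs F ^^ d u" unfolding d_def by (rule LeastI)
    with ne have "d u \<noteq> 0" by (intro notI) simp
    then obtain m where m: "d u = Suc m" by (cases "d u") auto
    then obtain v where v: "(u, v) \<in> parcs F" "(v, r u) \<in> parcs F ^^ m"
      using relpow_Suc_D2[OF du[unfolded m]] by blast
    then have "r v = r u" using r_cong[of u v] by simp
    then have "d v \<le> m" unfolding d_def using v(2) by (intro Least_le) simp
    then show ?thesis using v m by auto
  qed
  define f where "f = (\<lambda>u\<in>?V. if u = r u then u else SOME v. (u, v) \<in> parcs F \<and> d v < d u)"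
  have f_fix: "f u = u" if "u \<in> ?V" "u = r u" for u using that by (simp add: f_def)
  have f_step: "(u, f u) \<in> parcs F \<and> d (f u) < d u" if "u \<in> ?V" "u \<noteq> r u" for u
    using someI_ex[OF closer[OF that]] that by (simp add: f_def)
  have halts: "halts f u" if "u \<in> ?V" for u
    using that
  proof (induction "d u" arbitrary: u rule: less_induct)
    case less
    show ?case
    proof (cases "u = r u")
      case True
      then have "f u = u" using less by (intro f_fix)
      then show ?thesis unfolding halts_def by (intro exI[of _ 0]) simp
    next
      case False
      then have "(u, f u) \<in> parcs F" "d (f u) < d u" using f_step less by auto
      then show ?thesis using less VF F.in_arcsD2 halts_step by metis
    qed
  qed
  have f_mem: "f \<in> parent_maps H"
    using f_fix f_step sub halts by (auto simp: parent_maps_def PiE_iff f_def)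
  note D = parent_mapsD[OF H f_mem]
  have root_of_f: "root_of f u = r u" if "halts f u" "u \<in> ?V" for u
    using that
  proof (induction rule: halts_induct)
    case (root u)
    then have "u = r u" using f_step[of u] by auto
    then show ?case using root by (simp add: root_of_root)
  next
    case (step u)
    then have "u \<noteq> r u" using f_fix by auto
    then have "(u, f u) \<in> parcs F" using f_step step by auto
    then have "r (f u) = r u" "f u \<in> ?V" using r_cong[of u "f u"] VF F.in_arcsD2 by auto
    then show ?case using step by (simp add: root_of_step)
  qed
  interpret T: pair_graph "forest_of ?V f" by (rule pair_graph_forest_of[OF fin])
  have subF: "parcs (forest_of ?V f) \<subseteq> parcs F"
  proof -
    have "(u, f u) \<in> parcs F" if "u \<in> ?V" "f u \<noteq> u" for u using f_step f_fix that by metis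
    then show ?thesis using F.arcs_symmetric by auto
  qed
  have "parcs F \<subseteq> parcs (forest_of ?V f)"
  proof
    fix e assume "e \<in> parcs F"
    then obtain u v where e: "e = (u, v)" and uv: "(u, v) \<in> parcs F" by (cases e) auto
    then have V: "u \<in> ?V" "v \<in> ?V" using VF F.in_arcsD1 F.in_arcsD2 by auto
    then have "root_of f u = root_of f v" using r_cong[of u v] uv root_of_f halts by simp
    then have "u \<rightarrow>\<^sup>*\<^bsub>with_proj (forest_of ?V f)\<^esub> v"
      using V by (simp add: reachable_forest_of_iff[OF fin D(1,2)])
    then show "e \<in> parcs (forest_of ?V f)"
      unfolding e by (rule acyclic_graph_arc_of_reachable[OF acyc T.pair_graph subF uv])
  qed
  then have FT: "forest_of ?V f = F" using subF VF by (intro pair_pre_digraph.equality) auto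
  have "(\<lambda>S\<in>F.sccs_verts. root_of f (SOME u. u \<in> S)) = rt"
  proof (rule extensionalityI)
    show "rt \<in> extensional F.sccs_verts" using rt by (auto simp: PiE_iff)
    fix S assume S: "S \<in> F.sccs_verts"
    define s where "s = (SOME u. u \<in> S)"
    have "S \<noteq> {}" using S by (simp add: F.in_sccs_verts_conv_reachable)
    then have s: "s \<in> S" unfolding s_def by (simp add: some_in_eq)
    have C: "S = ?C s" by (rule F.sccs_verts_eq[OF S s])
    have "s \<rightarrow>\<^sup>*\<^bsub>with_proj F\<^esub> s"
      using S s by (simp add: F.in_sccs_verts_conv_reachable)
    then have "s \<in> ?V" using VF F.reachable_in_verts by simp
    then have "root_of f s = r s" using root_of_f halts by simp
    also have "\<dots> = rt S" by (simp only: r_def C[symmetric])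
    finally show "(\<lambda>S\<in>F.sccs_verts. root_of f (SOME u. u \<in> S)) S = rt S"
      using S by (simp add: s_def)
  qed simp
  then have "rooted_forest_of ?V f = (F, rt)" by (simp add: rooted_forest_of_def FT)
  then show ?thesis using f_mem by (metis image_eqI)
qed

lemma num_rooted_forests_eq_parent_maps:
  assumes "pair_graph H"
  shows "num_rooted_forests H = card (parent_maps H)"
proof -
  have "rooted_spanning_forests H = rooted_forest_of (pverts H) ` parent_maps H"
    using rooted_forest_of_surj[OF assms] rooted_forest_of_mem[OF assms] by auto
  then show ?thesis
    using card_image[OF inj_rooted_forest_of[OF assms]] by (simp add: num_rooted_forests_def)
qed

section \<open>Schur complements\<close>

text \<open>
  A vector in the kernel cannot have an entry of maximal absolute value that is nonzero: the diagonal
  term in the corresponding row would outweigh all the others.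
\<close>

lemma det_nonzero_if_diagonally_dominant:
  fixes A :: "real mat"
  assumes A: "A \<in> carrier_mat n n"
    and dom: "\<And>i. i < n \<Longrightarrow> (\<Sum>j\<in>{0..<n} - {i}. \<bar>A $$ (i, j)\<bar>) < \<bar>A $$ (i, i)\<bar>"
  shows "det A \<noteq> 0"
proof
  assume "det A = 0"
  then obtain x where x: "x \<in> carrier_vec n" "x \<noteq> 0\<^sub>v n" "A *\<^sub>v x = 0\<^sub>v n"
    using det_0_iff_vec_prod_zero[OF A] by blast
  have "\<exists>k<n. x $ k \<noteq> 0"
  proof (rule ccontr)
    assume "\<not> (\<exists>k<n. x $ k \<noteq> 0)"
    then have "x = 0\<^sub>v n" using x(1) by (intro eq_vecI) auto
    then show False using x(2) by simp
  qed
  then obtain k where k: "k < n" "x $ k \<noteq> 0" by blast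
  define X where "X = (\<lambda>j. \<bar>x $ j\<bar>) ` {0..<n}"
  have X: "X \<noteq> {}" "finite X" using k by (auto simp: X_def)
  then have "Max X \<in> X" by (intro Max_in)
  then obtain i where i: "i < n" "\<bar>x $ i\<bar> = Max X" unfolding X_def by fastforce
  have le: "\<bar>x $ j\<bar> \<le> \<bar>x $ i\<bar>" if "j < n" for j
    unfolding i(2) using that X(2) by (intro Max_ge) (auto simp: X_def)
  have pos: "\<bar>x $ i\<bar> > 0" using le[OF k(1)] k(2) by linarith
  have "0 = (A *\<^sub>v x) $ i" using x(3) i by simp
  also have "\<dots> = (\<Sum>j = 0..<n. A $$ (i, j) * x $ j)"
    using A x(1) i by (simp add: scalar_prod_def)
  also have "\<dots> = A $$ (i, i) * x $ i + (\<Sum>j\<in>{0..<n} - {i}. A $$ (i, j) * x $ j)"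
    using i by (intro sum.remove) auto
  finally have "\<bar>A $$ (i, i) * x $ i\<bar> = \<bar>\<Sum>j\<in>{0..<n} - {i}. A $$ (i, j) * x $ j\<bar>" by linarith
  also have "\<dots> \<le> (\<Sum>j\<in>{0..<n} - {i}. \<bar>A $$ (i, j)\<bar> * \<bar>x $ i\<bar>)"
    by (rule order_trans[OF sum_abs sum_mono]) (auto simp: abs_mult intro: mult_left_mono le)
  also have "\<dots> = (\<Sum>j\<in>{0..<n} - {i}. \<bar>A $$ (i, j)\<bar>) * \<bar>x $ i\<bar>"
    by (simp add: sum_distrib_right)
  also have "\<dots> < \<bar>A $$ (i, i)\<bar> * \<bar>x $ i\<bar>"
    using dom[OF i(1)] pos by (rule mult_strict_right_mono)
  finally show False by (simp add: abs_mult)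
qed

lemma mat_inverse_inverts:
  fixes A :: "'a::field mat"
  assumes A: "A \<in> carrier_mat n n" and d: "det A \<noteq> 0"
  shows "A * the (mat_inverse A) = 1\<^sub>m n" "the (mat_inverse A) \<in> carrier_mat n n"
proof -
  obtain B where "mat_inverse A = Some B"
    using mat_inverse(1)[OF A, of "()"] det_non_zero_imp_unit[OF A d, of "()"] by (cases "mat_inverse A") auto
  then show "A * the (mat_inverse A) = 1\<^sub>m n" "the (mat_inverse A) \<in> carrier_mat n n"
    using mat_inverse(2)[OF A] by auto
qed

text \<open>
  Block elimination: the matrix is the product of the lower triangular block matrix with diagonal
  blocks \<open>A\<close> and \<open>D - C A' B\<close> and a unitriangular one.
\<close>

lemma det_Schur_complement:
  fixes A :: "'a::idom mat"
  assumes A: "A \<in> carrier_mat n n" and A': "A' \<in> carrier_mat n n" and inv: "A * A' = 1\<^sub>m n"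
    and B: "B \<in> carrier_mat n m" and C: "C \<in> carrier_mat m n" and D: "D \<in> carrier_mat m m"
  shows "det (four_block_mat A B C D) = det A * det (D - C * A' * B)"
proof -
  define U where "U = A' * B"
  define S where "S = D - C * A' * B"
  have U: "U \<in> carrier_mat n m" unfolding U_def by (rule mult_carrier_mat[OF A' B])
  have CU: "C * U = C * A' * B" unfolding U_def by (rule assoc_mult_mat[OF C A' B, symmetric])
  have CUm: "C * U \<in> carrier_mat m m" by (rule mult_carrier_mat[OF C U])
  have S: "S \<in> carrier_mat m m" unfolding S_def CU[symmetric] by (rule minus_carrier_mat[OF CUm])
  have "A * U = A * A' * B" unfolding U_def by (rule assoc_mult_mat[OF A A' B, symmetric])
  then have AU: "A * U = B" using B by (simp add: inv)
  have DS: "C * U + S = D"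
  proof -
    have "X + (D - X) = D" if "X \<in> carrier_mat m m" for X
      using D that by (intro eq_matI) auto
    from this[OF CUm] show ?thesis unfolding S_def CU .
  qed
  let ?L = "four_block_mat A (0\<^sub>m n m) C S"
  let ?R = "four_block_mat (1\<^sub>m n) U (0\<^sub>m m n) (1\<^sub>m m)"
  have "?L * ?R = four_block_mat (A * 1\<^sub>m n + 0\<^sub>m n m * 0\<^sub>m m n) (A * U + 0\<^sub>m n m * 1\<^sub>m m)
      (C * 1\<^sub>m n + S * 0\<^sub>m m n) (C * U + S * 1\<^sub>m m)"
    by (rule mult_four_block_mat[OF A zero_carrier_mat C S one_carrier_mat U zero_carrier_mat
          one_carrier_mat])
  also have "\<dots> = four_block_mat A B C D"
    using A B C S by (simp add: AU DS)
  finally have "det (four_block_mat A B C D) = det (?L * ?R)" by (rule arg_cong[OF sym])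
  also have "\<dots> = det ?L * det ?R"
    by (rule det_mult[OF four_block_carrier_mat[OF A S] four_block_carrier_mat[OF one_carrier_mat one_carrier_mat]])
  also have "det ?L = det A * det S"
    by (rule det_four_block_mat_upper_right_zero[OF A refl C S])
  also have "det ?R = 1"
    using det_four_block_mat_lower_left_zero[OF one_carrier_mat U refl one_carrier_mat]
    by (simp only: det_one mult_1)
  finally show ?thesis by (simp only: S_def mult_1_right)
qed

text \<open>
  If the eliminated block is itself block diagonal, both diagonal blocks are eliminated independently.
  The blocks of width or height 0 merely stack \<open>B1\<close> on top of \<open>B2\<close> and put \<open>C1\<close> beside \<open>C2\<close>.
\<close>

lemma det_Schur_complement_two_blocks:
  fixes A1 A2 :: "'a::idom mat"
  assumes A1: "A1 \<in> carrier_mat n n" and A1': "A1' \<in> carrier_mat n n" and inv1: "A1 * A1' = 1\<^sub>m n"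
    and A2: "A2 \<in> carrier_mat m m" and A2': "A2' \<in> carrier_mat m m" and inv2: "A2 * A2' = 1\<^sub>m m"
    and B1: "B1 \<in> carrier_mat n l" and B2: "B2 \<in> carrier_mat m l"
    and C1: "C1 \<in> carrier_mat l n" and C2: "C2 \<in> carrier_mat l m" and D: "D \<in> carrier_mat l l"
  shows "det (four_block_mat (four_block_mat A1 (0\<^sub>m n m) (0\<^sub>m m n) A2)
        (four_block_mat B1 (0\<^sub>m n 0) B2 (0\<^sub>m m 0)) (four_block_mat C1 C2 (0\<^sub>m 0 n) (0\<^sub>m 0 m)) D) =
      det A1 * det A2 * det (D - (C1 * A1' * B1 + C2 * A2' * B2))"
proof -
  let ?A = "four_block_mat A1 (0\<^sub>m n m) (0\<^sub>m m n) A2"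
  let ?A' = "four_block_mat A1' (0\<^sub>m n m) (0\<^sub>m m n) A2'"
  let ?B = "four_block_mat B1 (0\<^sub>m n 0) B2 (0\<^sub>m m 0)"
  let ?C = "four_block_mat C1 C2 (0\<^sub>m 0 n) (0\<^sub>m 0 m)"
  note zero = zero_carrier_mat
  have dims: "?A \<in> carrier_mat (n + m) (n + m)" "?A' \<in> carrier_mat (n + m) (n + m)"
    by (rule four_block_carrier_mat[OF A1 A2], rule four_block_carrier_mat[OF A1' A2'])
  have B: "?B \<in> carrier_mat (n + m) l"
    using four_block_carrier_mat[OF B1 zero_carrier_mat[of m 0]] by simp
  have C: "?C \<in> carrier_mat l (n + m)"
    using four_block_carrier_mat[OF C1 zero_carrier_mat[of 0 m]] by simp
  have CA1: "C1 * A1' \<in> carrier_mat l n" and CA2: "C2 * A2' \<in> carrier_mat l m"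
    by (rule mult_carrier_mat[OF C1 A1'], rule mult_carrier_mat[OF C2 A2'])
  define P where "P = C1 * A1' * B1 + C2 * A2' * B2"
  have P: "P \<in> carrier_mat l l"
    unfolding P_def by (rule add_carrier_mat[OF mult_carrier_mat[OF CA2 B2]])
  have "?A * ?A' = four_block_mat (A1 * A1' + 0\<^sub>m n m * 0\<^sub>m m n) (A1 * 0\<^sub>m n m + 0\<^sub>m n m * A2')
      (0\<^sub>m m n * A1' + A2 * 0\<^sub>m m n) (0\<^sub>m m n * 0\<^sub>m n m + A2 * A2')"
    by (rule mult_four_block_mat[OF A1 zero zero A2 A1' zero zero A2'])
  also have "\<dots> = 1\<^sub>m (n + m)" using A1 A1' A2 A2' by (simp add: inv1 inv2)
  finally have inv: "?A * ?A' = 1\<^sub>m (n + m)" .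
  have "?C * ?A' = four_block_mat (C1 * A1' + C2 * 0\<^sub>m m n) (C1 * 0\<^sub>m n m + C2 * A2')
      (0\<^sub>m 0 n * A1' + 0\<^sub>m 0 m * 0\<^sub>m m n) (0\<^sub>m 0 n * 0\<^sub>m n m + 0\<^sub>m 0 m * A2')"
    by (rule mult_four_block_mat[OF C1 C2 zero zero A1' zero zero A2'])
  also have "\<dots> = four_block_mat (C1 * A1') (C2 * A2') (0\<^sub>m 0 n) (0\<^sub>m 0 m)"
    using A1' A2' C1 C2 CA1 CA2 by simp
  finally have CA: "?C * ?A' = four_block_mat (C1 * A1') (C2 * A2') (0\<^sub>m 0 n) (0\<^sub>m 0 m)" .
  have "?C * ?A' * ?B = four_block_mat P
      (C1 * A1' * 0\<^sub>m n 0 + C2 * A2' * 0\<^sub>m m 0) (0\<^sub>m 0 n * B1 + 0\<^sub>m 0 m * B2)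
      (0\<^sub>m 0 n * 0\<^sub>m n 0 + 0\<^sub>m 0 m * 0\<^sub>m m 0)"
    unfolding CA P_def by (rule mult_four_block_mat[OF CA1 CA2 zero zero B1 zero B2 zero])
  also have "\<dots> = P"
    using P CA1 CA2 B1 B2 by (intro eq_matI) auto
  finally have prod: "?C * ?A' * ?B = P" .
  have "det ?A = det A1 * det A2"
    by (rule det_four_block_mat_upper_right_zero[OF A1 refl zero A2])
  then show ?thesis
    using det_Schur_complement[OF dims(1,2) inv B C D] by (simp only: prod P_def)
qed

lemma mat_diff_regroup:
  fixes D1 D2 D3 X1 X2 :: "'a::ab_group_add mat"
  assumes "D1 \<in> carrier_mat l k" "D2 \<in> carrier_mat l k" "D3 \<in> carrier_mat l k"
    "X1 \<in> carrier_mat l k" "X2 \<in> carrier_mat l k"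
  shows "(D1 - X1) + (D2 - X2) - D3 = (D1 + D2 - D3) - (X1 + X2)"
  using assms by (intro eq_matI) auto

section \<open>Blocks of the shifted Laplacian\<close>

definition enum_append :: "nat \<Rightarrow> (nat \<Rightarrow> 'a) \<Rightarrow> (nat \<Rightarrow> 'a) \<Rightarrow> nat \<Rightarrow> 'a" where
  "enum_append n e f i = (if i < n then e i else f (i - n))"

lemma bij_betw_enum_append:
  assumes e: "bij_betw e {..<n} I" and f: "bij_betw f {..<m} J" and disj: "I \<inter> J = {}"
  shows "bij_betw (enum_append n e f) {..<n + m} (I \<union> J)"
proof -
  have "bij_betw (enum_append n e f) {..<n} I"
  proof -
    have "bij_betw (enum_append n e f) {..<n} I \<longleftrightarrow> bij_betw e {..<n} I"
      by (rule bij_betw_cong) (simp add: enum_append_def)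
    then show ?thesis using e by simp
  qed
  moreover have "bij_betw (enum_append n e f) {n..<n + m} J"
  proof -
    have "bij_betw (\<lambda>i. i - n) {n..<n + m} {..<m}"
      by (rule bij_betw_byWitness[of _ "\<lambda>i. i + n"]) auto
    then have "bij_betw (f \<circ> (\<lambda>i. i - n)) {n..<n + m} J" using f by (rule bij_betw_trans)
    moreover have "bij_betw (enum_append n e f) {n..<n + m} J \<longleftrightarrow>
        bij_betw (f \<circ> (\<lambda>i. i - n)) {n..<n + m} J"
      by (rule bij_betw_cong) (simp add: enum_append_def)
    ultimately show ?thesis by simp
  qed
  ultimately have "bij_betw (enum_append n e f) ({..<n} \<union> {n..<n + m}) (I \<union> J)"
    using disj by (rule bij_betw_combine)
  moreover have "{..<n} \<union> {n..<n + m} = {..<n + m}" by auto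
  ultimately show ?thesis by simp
qed

abbreviation enum_mat ::
    "('a \<Rightarrow> 'b \<Rightarrow> real) \<Rightarrow> nat \<Rightarrow> (nat \<Rightarrow> 'a) \<Rightarrow> nat \<Rightarrow> (nat \<Rightarrow> 'b) \<Rightarrow> real mat" where
  "enum_mat M n e k f \<equiv> mat n k (\<lambda>(i, j). M (e i) (f j))"

lemma enum_mat_append:
  "enum_mat M (n + m) (enum_append n e f) (k + l) (enum_append k g h) =
    four_block_mat (enum_mat M n e k g) (enum_mat M n e l h) (enum_mat M m f k g) (enum_mat M m f l h)"
  by (rule eq_matI) (auto simp: enum_append_def)

lemma enum_mat_append_rows:
  "enum_mat M (n + m) (enum_append n e f) l h =
    four_block_mat (enum_mat M n e l h) (0\<^sub>m n 0) (enum_mat M m f l h) (0\<^sub>m m 0)"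
  by (rule eq_matI) (auto simp: enum_append_def)

lemma enum_mat_append_cols:
  "enum_mat M l h (n + m) (enum_append n e f) =
    four_block_mat (enum_mat M l h n e) (enum_mat M l h m f) (0\<^sub>m 0 n) (0\<^sub>m 0 m)"
  by (rule eq_matI) (auto simp: enum_append_def)

lemma C_block_eq:
  "C_block H lam I J =
    enum_mat (shifted_laplacian H lam) (card I) (from_nat_into I) (card J) (from_nat_into J)"
  by (rule eq_matI) (simp_all add: C_block_def shifted_laplacian_def Let_def)

lemma shifted_laplacian_sym:
  assumes "pair_graph H"
  shows "shifted_laplacian H lam u v = shifted_laplacian H lam v u"
proof -
  interpret H: pair_graph H by fact
  have "(u, v) \<in> parcs H \<longleftrightarrow> (v, u) \<in> parcs H" using H.arcs_symmetric by blast
  then show ?thesis by (simp add: shifted_laplacian_def laplacian_def)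
qed

lemma transpose_C_block:
  assumes "pair_graph H"
  shows "transpose_mat (C_block H lam I J) = C_block H lam J I"
  by (rule eq_matI) (simp_all add: C_block_eq, rule shifted_laplacian_sym[OF assms])

text \<open>
  A vertex has at most as many neighbours inside \<open>I\<close> as in the whole graph, so for positive \<open>lam\<close> each
  principal submatrix of \<open>L(H) + lam I\<close> is strictly diagonally dominant.
\<close>

lemma det_shifted_laplacian_nonzero:
  assumes H: "pair_graph H" and lam: "lam > 0" and e: "bij_betw e {..<n} I"
  shows "det (enum_mat (shifted_laplacian H lam) n e n e) \<noteq> 0"
proof (rule det_nonzero_if_diagonally_dominant)
  interpret H: pair_graph H by fact
  let ?M = "enum_mat (shifted_laplacian H lam) n e n e"
  show "?M \<in> carrier_mat n n" by simp
  fix i assume i: "i < n"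
  let ?N = "{v. (e i, v) \<in> parcs H}"
  have inj: "inj_on e {0..<n}" using e by (auto simp: bij_betw_def atLeast0LessThan)
  have finN: "finite ?N"
    by (rule finite_subset[OF _ H.pair_finite_verts]) (auto dest: H.in_arcsD2)
  have "(\<Sum>j\<in>{0..<n} - {i}. \<bar>?M $$ (i, j)\<bar>) = (\<Sum>j\<in>{0..<n} - {i}. if e j \<in> ?N then 1 else 0)"
    using i inj by (intro sum.cong) (auto simp: shifted_laplacian_def laplacian_def inj_on_def)
  also have "\<dots> = real (card {j \<in> {0..<n} - {i}. e j \<in> ?N})"
    by (simp add: sum.inter_filter[symmetric])
  also have "\<dots> \<le> real (card ?N)"
  proof -
    have "inj_on e {j \<in> {0..<n} - {i}. e j \<in> ?N}" using inj by (rule inj_on_subset) auto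
    then have "card {j \<in> {0..<n} - {i}. e j \<in> ?N} \<le> card ?N"
      by (rule card_inj_on_le) (auto simp: finN)
    then show ?thesis by simp
  qed
  also have "\<dots> < \<bar>?M $$ (i, i)\<bar>"
    using i lam by (simp add: shifted_laplacian_def laplacian_def out_degree_conv_card)
  finally show "(\<Sum>j\<in>{0..<n} - {i}. \<bar>?M $$ (i, j)\<bar>) < \<bar>?M $$ (i, i)\<bar>" .
qed

lemma num_rooted_forests_eq_det:
  assumes "pair_graph H" and "bij_betw e {..<n} (pverts H)"
  shows "real (num_rooted_forests H) = det (enum_mat (shifted_laplacian H 1) n e n e)"
  using det_laplacian_parent_maps[OF assms] num_rooted_forests_eq_parent_maps[OF assms(1)] by simp

lemma DN_eq:
  assumes "pair_graph H"
  shows "DN H Y lam = C_block H lam (pverts Y) (pverts Y) -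
    C_block H lam (pverts Y) (pverts H - pverts Y) *
      the (mat_inverse (C_block H lam (pverts H - pverts Y) (pverts H - pverts Y))) *
    C_block H lam (pverts H - pverts Y) (pverts Y)"
  by (simp only: DN_def Let_def transpose_C_block[OF assms])

text \<open>
  With the vertices of \<open>Y\<close> listed last, \<open>DN H Y 1\<close> is the Schur complement of the block of the other
  vertices in \<open>L(H) + I\<close>.
\<close>

lemma num_rooted_forests_eq_det_DN:
  assumes H: "pair_graph H" and Y: "pverts Y \<subseteq> pverts H"
  shows "real (num_rooted_forests H) =
      det (C_block H 1 (pverts H - pverts Y) (pverts H - pverts Y)) * det (DN H Y 1)"
    and "det (C_block H 1 (pverts H - pverts Y) (pverts H - pverts Y)) \<noteq> 0"
    and "det (DN H Y 1) \<noteq> 0"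
proof -
  interpret H: pair_graph H by fact
  let ?I = "pverts H - pverts Y" and ?J = "pverts Y"
  let ?M = "shifted_laplacian H 1"
  have fin: "finite ?I" "finite ?J"
    using H.pair_finite_verts finite_subset[OF Y] by simp_all
  define n e where "n = card ?I" and "e = from_nat_into ?I"
  define m f where "m = card ?J" and "f = from_nat_into ?J"
  have e: "bij_betw e {..<n} ?I" unfolding e_def n_def by (rule bij_betw_from_nat_into_finite[OF fin(1)])
  have f: "bij_betw f {..<m} ?J" unfolding f_def m_def by (rule bij_betw_from_nat_into_finite[OF fin(2)])
  let ?A = "enum_mat ?M n e n e" and ?B = "enum_mat ?M n e m f"
  let ?C = "enum_mat ?M m f n e" and ?D = "enum_mat ?M m f m f"
  have A: "C_block H 1 ?I ?I = ?A" and B: "C_block H 1 ?I ?J = ?B"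
    and C: "C_block H 1 ?J ?I = ?C" and D: "C_block H 1 ?J ?J = ?D"
    by (simp_all add: C_block_eq e_def f_def n_def m_def)
  show dA: "det (C_block H 1 ?I ?I) \<noteq> 0"
    unfolding A by (rule det_shifted_laplacian_nonzero[OF H _ e]) simp
  let ?A' = "the (mat_inverse ?A)"
  have inv: "?A * ?A' = 1\<^sub>m n" "?A' \<in> carrier_mat n n"
    using mat_inverse_inverts[of ?A n] dA A by simp_all
  have DN: "DN H Y 1 = ?D - ?C * ?A' * ?B"
    by (simp only: DN_eq[OF H] A B C D)
  have g: "bij_betw (enum_append n e f) {..<n + m} (pverts H)"
  proof -
    have "?I \<union> ?J = pverts H" using Y by blast
    then show ?thesis using bij_betw_enum_append[OF e f] by auto
  qed
  have "det (four_block_mat ?A ?B ?C ?D) = det ?A * det (DN H Y 1)"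
    unfolding DN by (rule det_Schur_complement[where n = n and m = m, OF _ inv(2,1)]) simp_all
  then have eq: "det (enum_mat ?M (n + m) (enum_append n e f) (n + m) (enum_append n e f)) = det ?A * det (DN H Y 1)"
    by (simp only: enum_mat_append[where M = ?M])
  then show "real (num_rooted_forests H) = det (C_block H 1 ?I ?I) * det (DN H Y 1)"
    unfolding num_rooted_forests_eq_det[OF H g] A .
  have "det (enum_mat ?M (n + m) (enum_append n e f) (n + m) (enum_append n e f)) \<noteq> 0"
    by (rule det_shifted_laplacian_nonzero[OF H _ g]) simp
  then show "det (DN H Y 1) \<noteq> 0" unfolding eq by simp
qed

section \<open>The Laplacian of a glued graph\<close>

text \<open>
  The equivalence class of the vertex \<open>u\<close> of the first graph, and below that of the second: it has
  two elements exactly for the shared vertices.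
\<close>

definition left_copy :: "'a pair_pre_digraph \<Rightarrow> 'a \<Rightarrow> ('a + 'a) set" where
  "left_copy Y u = (if u \<in> pverts Y then {Inl u, Inr u} else {Inl u})"

definition right_copy :: "'a pair_pre_digraph \<Rightarrow> 'a \<Rightarrow> ('a + 'a) set" where
  "right_copy Y u = (if u \<in> pverts Y then {Inl u, Inr u} else {Inr u})"

lemma left_copy_eq_iff [simp]: "left_copy Y u = left_copy Y v \<longleftrightarrow> u = v"
  by (auto simp: left_copy_def doubleton_eq_iff)

lemma right_copy_eq_iff [simp]: "right_copy Y u = right_copy Y v \<longleftrightarrow> u = v"
  by (auto simp: right_copy_def doubleton_eq_iff)

lemma left_copy_eq_right_copy_iff [simp]:
  "left_copy Y u = right_copy Y v \<longleftrightarrow> u = v \<and> u \<in> pverts Y"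
  "right_copy Y v = left_copy Y u \<longleftrightarrow> u = v \<and> u \<in> pverts Y"
  by (auto simp: left_copy_def right_copy_def doubleton_eq_iff)

lemma right_copy_shared: "u \<in> pverts Y \<Longrightarrow> right_copy Y u = left_copy Y u"
  by simp

lemma glue_rel_Image:
  "glue_rel Y `` {Inl u} = left_copy Y u" "glue_rel Y `` {Inr u} = right_copy Y u"
  by (auto simp: glue_rel_def left_copy_def right_copy_def)

lemma pverts_glue: "pverts (glue G1 Y G2) = left_copy Y ` pverts G1 \<union> right_copy Y ` pverts G2"
proof -
  have "A // r = (\<lambda>x. r `` {x}) ` A" for A and r :: "('a + 'a) rel" by (auto simp: quotient_def)
  then show ?thesis by (simp add: glue_def Plus_def image_Un image_image glue_rel_Image)
qed

lemma parcs_glue: "parcs (glue G1 Y G2) =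
    (\<lambda>(u, v). (left_copy Y u, left_copy Y v)) ` parcs G1 \<union>
    (\<lambda>(u, v). (right_copy Y u, right_copy Y v)) ` parcs G2"
  by (simp add: glue_def glue_rel_Image)

lemma parcs_glue_iff: "(x, y) \<in> parcs (glue G1 Y G2) \<longleftrightarrow>
    (\<exists>u v. x = left_copy Y u \<and> y = left_copy Y v \<and> (u, v) \<in> parcs G1) \<or>
    (\<exists>u v. x = right_copy Y u \<and> y = right_copy Y v \<and> (u, v) \<in> parcs G2)"
proof -
  have img: "(x, y) \<in> (\<lambda>(u, v). (p u, p v)) ` E \<longleftrightarrow> (\<exists>u v. x = p u \<and> y = p v \<and> (u, v) \<in> E)"
    for p :: "'a \<Rightarrow> ('a + 'a) set" and E by force
  show ?thesis by (simp only: parcs_glue Un_iff img)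
qed

locale gluing =
  fixes G1 G2 Y :: "'a pair_pre_digraph"
  assumes G1: "pair_graph G1" and G2: "pair_graph G2"
    and Y1: "induced_subgraph (with_proj Y) (with_proj G1)"
    and Y2: "induced_subgraph (with_proj Y) (with_proj G2)"
begin

sublocale G1: pair_graph G1 by (rule G1)
sublocale G2: pair_graph G2 by (rule G2)

abbreviation "G \<equiv> glue G1 Y G2"
abbreviation "V1 \<equiv> pverts G1"
abbreviation "V2 \<equiv> pverts G2"
abbreviation "W \<equiv> pverts Y"
abbreviation "q1 \<equiv> left_copy Y"
abbreviation "q2 \<equiv> right_copy Y"

lemma W_subset: "W \<subseteq> V1" "W \<subseteq> V2"
  using Y1 Y2 by (auto simp: induced_subgraph_def subgraph_def)

lemma parcs_Y_iff:
  "(u, v) \<in> parcs Y \<longleftrightarrow> (u, v) \<in> parcs G1 \<and> u \<in> W \<and> v \<in> W"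
  "(u, v) \<in> parcs Y \<longleftrightarrow> (u, v) \<in> parcs G2 \<and> u \<in> W \<and> v \<in> W"
proof -
  have "parcs Y = {e \<in> parcs G1. fst e \<in> W \<and> snd e \<in> W}"
    using Y1 by (simp add: induced_subgraph_def)
  then show "(u, v) \<in> parcs Y \<longleftrightarrow> (u, v) \<in> parcs G1 \<and> u \<in> W \<and> v \<in> W" by simp
  have "parcs Y = {e \<in> parcs G2. fst e \<in> W \<and> snd e \<in> W}"
    using Y2 by (simp add: induced_subgraph_def)
  then show "(u, v) \<in> parcs Y \<longleftrightarrow> (u, v) \<in> parcs G2 \<and> u \<in> W \<and> v \<in> W" by simp
qed

lemma parcs_G1_iff: "u \<in> W \<Longrightarrow> v \<in> W \<Longrightarrow> (u, v) \<in> parcs G1 \<longleftrightarrow> (u, v) \<in> parcs G2"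
  using parcs_Y_iff(1)[of u v] parcs_Y_iff(2)[of u v] by blast

lemma parcs_iff:
  "(q1 u, q1 v) \<in> parcs G \<longleftrightarrow> (u, v) \<in> parcs G1"
  "(q2 u, q2 v) \<in> parcs G \<longleftrightarrow> (u, v) \<in> parcs G2"
  "u \<notin> W \<Longrightarrow> v \<notin> W \<Longrightarrow> (q1 u, q2 v) \<notin> parcs G"
  "u \<notin> W \<Longrightarrow> v \<notin> W \<Longrightarrow> (q2 u, q1 v) \<notin> parcs G"
  using parcs_G1_iff[of u v] unfolding parcs_glue_iff left_copy_eq_iff right_copy_eq_iff
    left_copy_eq_right_copy_iff by blast+

lemma out_neighbours_left:
  assumes "u \<notin> W"
  shows "{x. (q1 u, x) \<in> parcs G} = q1 ` {v. (u, v) \<in> parcs G1}"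
proof -
  have "(q1 u, x) \<in> parcs G \<longleftrightarrow> (\<exists>v. x = q1 v \<and> (u, v) \<in> parcs G1)" for x
    unfolding parcs_glue_iff using assms by simp
  then show ?thesis by (simp only: image_Collect Collect_disj_eq)
qed

lemma out_neighbours_right:
  assumes "u \<notin> W"
  shows "{x. (q2 u, x) \<in> parcs G} = q2 ` {v. (u, v) \<in> parcs G2}"
proof -
  have "(q2 u, x) \<in> parcs G \<longleftrightarrow> (\<exists>v. x = q2 v \<and> (u, v) \<in> parcs G2)" for x
    unfolding parcs_glue_iff using assms by simp
  then show ?thesis by (simp only: image_Collect Collect_disj_eq)
qed

lemma out_neighbours_shared:
  assumes "u \<in> W"
  shows "{x. (q1 u, x) \<in> parcs G} = q1 ` {v. (u, v) \<in> parcs G1} \<union> q2 ` {v. (u, v) \<in> parcs G2}"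
proof -
  have "(q1 u, x) \<in> parcs G \<longleftrightarrow>
      (\<exists>v. x = q1 v \<and> (u, v) \<in> parcs G1) \<or> (\<exists>v. x = q2 v \<and> (u, v) \<in> parcs G2)" for x
    unfolding parcs_glue_iff using assms by simp
  then show ?thesis by (simp only: image_Collect Collect_disj_eq)
qed

lemma shared_neighbours:
  assumes "u \<in> W"
  shows "q1 ` {v. (u, v) \<in> parcs G1} \<inter> q2 ` {v. (u, v) \<in> parcs G2} = q1 ` {v. (u, v) \<in> parcs Y}"
proof
  show "q1 ` {v. (u, v) \<in> parcs G1} \<inter> q2 ` {v. (u, v) \<in> parcs G2} \<subseteq> q1 ` {v. (u, v) \<in> parcs Y}"
    using assms by (auto simp: parcs_Y_iff(1))
  show "q1 ` {v. (u, v) \<in> parcs Y} \<subseteq> q1 ` {v. (u, v) \<in> parcs G1} \<inter> q2 ` {v. (u, v) \<in> parcs G2}"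
  proof
    fix x assume "x \<in> q1 ` {v. (u, v) \<in> parcs Y}"
    then obtain v where v: "x = q1 v" "(u, v) \<in> parcs Y" by blast
    then have "v \<in> W" using parcs_Y_iff(1)[of u v] by blast
    then have "x = q2 v" using v(1) right_copy_shared by metis
    then show "x \<in> q1 ` {v. (u, v) \<in> parcs G1} \<inter> q2 ` {v. (u, v) \<in> parcs G2}"
      using v parcs_Y_iff[of u v] by blast
  qed
qed

lemma pair_graph_glue: "pair_graph G"
proof (rule pair_graph_intro)
  show "finite (pverts G)"
    using G1.pair_finite_verts G2.pair_finite_verts by (simp add: pverts_glue)
  show "parcs G \<subseteq> pverts G \<times> pverts G"
    using G1.in_arcsD1 G1.in_arcsD2 G2.in_arcsD1 G2.in_arcsD2
    by (auto simp: parcs_glue pverts_glue)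
  show "sym (parcs G)"
    using G1.arcs_symmetric G2.arcs_symmetric by (force simp: sym_def parcs_glue)
  show "(x, x) \<notin> parcs G" for x
    using G1.no_loops' G2.no_loops' by (auto simp: parcs_glue)
qed

lemma card_image_copy:
  "card (q1 ` A) = card A" "card (q2 ` A) = card A"
  by (simp_all add: card_image inj_on_def)

lemma shifted_laplacian_left:
  assumes "u \<notin> W \<or> v \<notin> W"
  shows "shifted_laplacian G lam (q1 u) (q1 v) = shifted_laplacian G1 lam u v"
  using assms
  by (auto simp: shifted_laplacian_def laplacian_def parcs_iff out_degree_conv_card
      out_neighbours_left card_image_copy)

lemma shifted_laplacian_right:
  assumes "u \<notin> W \<or> v \<notin> W"
  shows "shifted_laplacian G lam (q2 u) (q2 v) = shifted_laplacian G2 lam u v"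
  using assms
  by (auto simp: shifted_laplacian_def laplacian_def parcs_iff out_degree_conv_card
      out_neighbours_right card_image_copy)

lemma shifted_laplacian_across:
  assumes "u \<notin> W" "v \<notin> W"
  shows "shifted_laplacian G lam (q1 u) (q2 v) = 0" "shifted_laplacian G lam (q2 v) (q1 u) = 0"
  using assms by (auto simp: shifted_laplacian_def laplacian_def parcs_iff)

text \<open>
  The neighbours of a shared vertex in the two graphs overlap exactly in its neighbours in \<open>Y\<close>.
\<close>

lemma out_degree_shared:
  assumes u: "u \<in> W"
  shows "out_degree (with_proj G1) u + out_degree (with_proj G2) u =
    out_degree (with_proj G) (q1 u) + out_degree (with_proj Y) u"
proof -
  have "{v. (u, v) \<in> parcs G1} \<subseteq> V1" "{v. (u, v) \<in> parcs G2} \<subseteq> V2"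
    by (auto dest: G1.in_arcsD2 G2.in_arcsD2)
  then have fin: "finite {v. (u, v) \<in> parcs G1}" "finite {v. (u, v) \<in> parcs G2}"
    using finite_subset G1.pair_finite_verts G2.pair_finite_verts by blast+
  show ?thesis
    unfolding out_degree_conv_card out_neighbours_shared[OF u]
    using card_Un_Int[OF finite_imageI[OF fin(1), of q1] finite_imageI[OF fin(2), of q2]]
    unfolding shared_neighbours[OF u] card_image_copy .
qed

text \<open>
  Edges of \<open>Y\<close> and the shift \<open>lam\<close> are counted twice in the first two summands, which the last corrects.
\<close>

lemma shifted_laplacian_shared:
  assumes u: "u \<in> W" and v: "v \<in> W"
  shows "shifted_laplacian G lam (q1 u) (q1 v) =
    shifted_laplacian G1 lam u v + shifted_laplacian G2 lam u v - shifted_laplacian Y lam u v"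
proof (cases "u = v")
  case True
  have "real (out_degree (with_proj G1) u) + real (out_degree (with_proj G2) u) =
    real (out_degree (with_proj G) (q1 u)) + real (out_degree (with_proj Y) u)"
    using arg_cong[OF out_degree_shared[OF u], of real] by (simp only: of_nat_add)
  then show ?thesis
    using True by (simp add: shifted_laplacian_def laplacian_def)
next
  case False
  have "(u, v) \<in> parcs G1 \<longleftrightarrow> (u, v) \<in> parcs G2" "(u, v) \<in> parcs Y \<longleftrightarrow> (u, v) \<in> parcs G2"
    using parcs_G1_iff[OF u v] parcs_Y_iff(2)[of u v] u v by blast+
  with False show ?thesis by (simp add: shifted_laplacian_def laplacian_def parcs_iff)
qed

text \<open>
  List the private vertices of \<open>G1\<close>, then those of \<open>G2\<close>, then the shared ones.  No edge joins the first
  two groups, so the block to be eliminated is block diagonal, and the Schur complement is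
  \<open>D1 + D2 - D_Y\<close> minus one correction for each graph, which is the glued Dirichlet-to-Neumann matrix.
\<close>

lemma num_rooted_forests_glue:
  "real (num_rooted_forests G) =
    det (C_block G1 1 (V1 - W) (V1 - W)) * det (C_block G2 1 (V2 - W) (V2 - W)) *
    det (DN_glue G1 Y G2 1)"
proof -
  let ?I = "V1 - W" and ?J = "V2 - W"
  have fin: "finite ?I" "finite ?J" "finite W"
    using G1.pair_finite_verts G2.pair_finite_verts finite_subset[OF W_subset(1)] by simp_all
  define n e where "n = card ?I" and "e = from_nat_into ?I"
  define m f where "m = card ?J" and "f = from_nat_into ?J"
  define l g where "l = card W" and "g = from_nat_into W"
  have e: "bij_betw e {..<n} ?I" unfolding e_def n_def by (rule bij_betw_from_nat_into_finite[OF fin(1)])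
  have f: "bij_betw f {..<m} ?J" unfolding f_def m_def by (rule bij_betw_from_nat_into_finite[OF fin(2)])
  have g: "bij_betw g {..<l} W" unfolding g_def l_def by (rule bij_betw_from_nat_into_finite[OF fin(3)])
  have eI: "e i \<in> V1" "e i \<notin> W" if "i < n" for i using e that by (auto simp: bij_betw_def)
  have fJ: "f i \<in> V2" "f i \<notin> W" if "i < m" for i using f that by (auto simp: bij_betw_def)
  have gW: "g i \<in> W" if "i < l" for i using g that by (auto simp: bij_betw_def)
  let ?M = "shifted_laplacian G 1"
  let ?M1 = "shifted_laplacian G1 1" and ?M2 = "shifted_laplacian G2 1"
  let ?MY = "shifted_laplacian Y 1"
  let ?e = "q1 \<circ> e" and ?f = "q2 \<circ> f" and ?g = "q1 \<circ> g"
  define c where "c = enum_append n ?e ?f"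
  define h where "h = enum_append (n + m) c ?g"
  have h: "bij_betw h {..<n + m + l} (pverts G)"
  proof -
    have copy: "bij_betw q1 A (q1 ` A)" "bij_betw q2 A (q2 ` A)" for A
      by (simp_all add: bij_betw_def inj_on_def)
    have "q1 ` ?I \<inter> q2 ` ?J = {}" "(q1 ` ?I \<union> q2 ` ?J) \<inter> q1 ` W = {}" by auto
    then have "bij_betw h {..<n + m + l} (q1 ` ?I \<union> q2 ` ?J \<union> q1 ` W)"
      unfolding h_def c_def
      by (intro bij_betw_enum_append bij_betw_trans[OF e copy(1)] bij_betw_trans[OF f copy(2)]
          bij_betw_trans[OF g copy(1)])
    moreover have "q1 ` ?I \<union> q2 ` ?J \<union> q1 ` W = pverts G"
    proof -
      have "q1 ` W = q2 ` W" by (rule image_cong) (simp_all add: right_copy_shared)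
      then have "q1 ` ?I \<union> q2 ` ?J \<union> q1 ` W = q1 ` (?I \<union> W) \<union> q2 ` (?J \<union> W)"
        unfolding image_Un by blast
      moreover have "?I \<union> W = V1" "?J \<union> W = V2" using W_subset by blast+
      ultimately show ?thesis by (simp add: pverts_glue)
    qed
    ultimately show ?thesis by simp
  qed
  let ?A1 = "enum_mat ?M1 n e n e" and ?A2 = "enum_mat ?M2 m f m f"
  let ?B1 = "enum_mat ?M1 n e l g" and ?B2 = "enum_mat ?M2 m f l g"
  let ?C1 = "enum_mat ?M1 l g n e" and ?C2 = "enum_mat ?M2 l g m f"
  let ?D1 = "enum_mat ?M1 l g l g" and ?D2 = "enum_mat ?M2 l g l g" and ?DY = "enum_mat ?MY l g l g"
  let ?D = "?D1 + ?D2 - ?DY"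
  have blocks:
    "C_block G1 1 ?I ?I = ?A1" "C_block G1 1 ?I W = ?B1" "C_block G1 1 W ?I = ?C1" "C_block G1 1 W W = ?D1"
    "C_block G2 1 ?J ?J = ?A2" "C_block G2 1 ?J W = ?B2" "C_block G2 1 W ?J = ?C2" "C_block G2 1 W W = ?D2"
    "C_block Y 1 W W = ?DY"
    by (simp_all add: C_block_eq e_def f_def g_def n_def m_def l_def)
  have shared: "q1 (g i) = q2 (g i)" if "i < l" for i
    by (rule right_copy_shared[OF gW[OF that], symmetric])
  have A: "enum_mat ?M n ?e n ?e = ?A1" "enum_mat ?M m ?f m ?f = ?A2"
    by (intro cong_mat refl; simp only: split_conv o_apply eI fJ shifted_laplacian_left
        shifted_laplacian_right simp_thms)+
  have O: "enum_mat ?M n ?e m ?f = 0\<^sub>m n m" "enum_mat ?M m ?f n ?e = 0\<^sub>m m n"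
    unfolding zero_mat_def
    by (intro cong_mat refl; simp only: split_conv o_apply eI fJ shifted_laplacian_across simp_thms)+
  have BC: "enum_mat ?M n ?e l ?g = ?B1" "enum_mat ?M l ?g n ?e = ?C1"
    by (intro cong_mat refl; simp only: split_conv o_apply eI shifted_laplacian_left simp_thms)+
  have BC': "enum_mat ?M m ?f l ?g = ?B2" "enum_mat ?M l ?g m ?f = ?C2"
    by (intro cong_mat refl; simp only: split_conv o_apply fJ shared shifted_laplacian_right simp_thms)+
  have D: "enum_mat ?M l ?g l ?g = ?D"
    by (rule eq_matI) (simp_all add: gW shifted_laplacian_shared)
  have nz: "det ?A1 \<noteq> 0" "det ?A2 \<noteq> 0"
    by (rule det_shifted_laplacian_nonzero[OF G1 _ e], simp)
      (rule det_shifted_laplacian_nonzero[OF G2 _ f], simp)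
  have split: "enum_mat ?M (n + m) c (n + m) c = four_block_mat ?A1 (0\<^sub>m n m) (0\<^sub>m m n) ?A2"
    "enum_mat ?M (n + m) c l ?g = four_block_mat ?B1 (0\<^sub>m n 0) ?B2 (0\<^sub>m m 0)"
    "enum_mat ?M l ?g (n + m) c = four_block_mat ?C1 ?C2 (0\<^sub>m 0 n) (0\<^sub>m 0 m)"
    unfolding c_def enum_mat_append[where M = ?M] A O
      enum_mat_append_rows[where M = ?M and h = ?g] enum_mat_append_cols[where M = ?M and h = ?g] BC BC' by (rule refl)+
  let ?A1' = "the (mat_inverse ?A1)" and ?A2' = "the (mat_inverse ?A2)"
  have inv: "?A1 * ?A1' = 1\<^sub>m n" "?A1' \<in> carrier_mat n n" "?A2 * ?A2' = 1\<^sub>m m" "?A2' \<in> carrier_mat m m"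
    using mat_inverse_inverts[of ?A1 n] mat_inverse_inverts[of ?A2 m] nz by simp_all
  have DN: "DN_glue G1 Y G2 1 = ?D - (?C1 * ?A1' * ?B1 + ?C2 * ?A2' * ?B2)"
  proof -
    have C1A: "?C1 * ?A1' \<in> carrier_mat l n" by (rule mult_carrier_mat[OF mat_carrier inv(2)])
    have C2A: "?C2 * ?A2' \<in> carrier_mat l m" by (rule mult_carrier_mat[OF mat_carrier inv(4)])
    have "DN_glue G1 Y G2 1 = (?D1 - ?C1 * ?A1' * ?B1) + (?D2 - ?C2 * ?A2' * ?B2) - ?DY"
      unfolding DN_glue_def C_mat_def DN_eq[OF G1] DN_eq[OF G2] blocks by (rule refl)
    also have "\<dots> = ?D - (?C1 * ?A1' * ?B1 + ?C2 * ?A2' * ?B2)"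
      by (rule mat_diff_regroup[OF mat_carrier mat_carrier mat_carrier
            mult_carrier_mat[OF C1A mat_carrier] mult_carrier_mat[OF C2A mat_carrier]])
    finally show ?thesis .
  qed
  have "real (num_rooted_forests G) = det (enum_mat ?M (n + m + l) h (n + m + l) h)"
    by (rule num_rooted_forests_eq_det[OF pair_graph_glue h])
  also have "\<dots> = det (four_block_mat (four_block_mat ?A1 (0\<^sub>m n m) (0\<^sub>m m n) ?A2)
      (four_block_mat ?B1 (0\<^sub>m n 0) ?B2 (0\<^sub>m m 0)) (four_block_mat ?C1 ?C2 (0\<^sub>m 0 n) (0\<^sub>m 0 m)) ?D)"
    unfolding h_def enum_mat_append[where M = ?M] split D ..
  also have "\<dots> = det ?A1 * det ?A2 * det (DN_glue G1 Y G2 1)"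
    unfolding DN
    by (rule det_Schur_complement_two_blocks[OF mat_carrier inv(2,1) mat_carrier inv(4,3)
          mat_carrier mat_carrier mat_carrier mat_carrier minus_carrier_mat[OF mat_carrier]])
  finally show ?thesis unfolding blocks .
qed

end

section \<open>Forests of a glued graph\<close>

theorem theorem3p4:
  fixes G1 G2 Y :: "'a pair_pre_digraph" and G :: "('a + 'a) set pair_pre_digraph"
  assumes "pair_graph G1" and "connected (with_proj G1)"
    and "pair_graph G2" and "connected (with_proj G2)"
    and "pair_graph Y" and "pverts Y \<noteq> {}"
    and "induced_subgraph (with_proj Y) (with_proj G1)"
    and "induced_subgraph (with_proj Y) (with_proj G2)"
    and "G = glue G1 Y G2"
  shows "real (num_rooted_forests G) =
    real (num_rooted_forests G1) * real (num_rooted_forests G2) *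
      (det (DN_glue G1 Y G2 1) / (det (DN G1 Y 1) * det (DN G2 Y 1)))"
proof -
  interpret gluing G1 G2 Y by (rule gluing.intro[OF assms(1,3,7,8)])
  have cancel: "a1 * a2 * d = (a1 * d1) * (a2 * d2) * (d / (d1 * d2))"
    if "d1 \<noteq> 0" "d2 \<noteq> 0" for a1 a2 d d1 d2 :: real
    using that by (simp add: field_simps)
  show ?thesis
    unfolding assms(9) num_rooted_forests_glue num_rooted_forests_eq_det_DN(1)[OF G1 W_subset(1)]
      num_rooted_forests_eq_det_DN(1)[OF G2 W_subset(2)]
    by (rule cancel[OF num_rooted_forests_eq_det_DN(3)[OF G1 W_subset(1)]
          num_rooted_forests_eq_det_DN(3)[OF G2 W_subset(2)]])
qed

end
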